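(* Let $G$ be a connected graph with $n(G)\ge 5$. Then $\dim_l(G)=n(G)-3$ if and only if one of the following holds: (i) $\omega(G)=n(G)-2$ and $G$ is $\{\Gamma_1,\Gamma_2\}$-free; (ii) $G\cong C_5$; (iii) $G\cong K_{n(G)}^{-}(\lambda,\mu)$ for some integers $\lambda\ge\mu\ge 2$ with $\lambda+\mu<n(G)$.
   Context: All graphs are finite and simple. $n(G)$ is the number of vertices and $\omega(G)$ the clique number of $G$. For vertices $x,y$ of a connected graph $G$, $d_G(x,y)$ is the length of a shortest $x,y$-path. A vertex $w$ distinguishes vertices $u,v$ if $d_G(u,w)\neq d_G(v,w)$. A set $W\subseteq V(G)$ is a local resolving set of $G$ if for every pair of adjacent vertices $u,v\in V(G)\setminus W$ some vertex of $W$ distinguishes $u$ and $v$. The local metric dimension $\dim_l(G)$ is the minimum cardinality of a local resolving set of $G$. For $n\ge 3$ and $1\le\mu\le\lambda$ with $\lambda+\mu\le n-1$, $K_n^{-}(\lambda,\mu)$ denotes the graph obtained from $K_n$ by deleting all edges of a subgraph isomorphic to $K_{\lambda,\mu}$. $\Gamma_1$ is the graph with vertex set $\{v_1,\dots,v_6\}$ and edge set $\{v_iv_j: i\ne j,\ i,j\in\{1,2,3,4\}\}\cup\{v_1v_5,v_1v_6,v_2v_5,v_3v_6\}$; $\Gamma_2$ is obtained from $\Gamma_1$ by adding the edge $v_5v_6$. A graph is $\{\Gamma_1,\Gamma_2\}$-free if it has no induced subgraph isomorphic to $\Gamma_1$ or to $\Gamma_2$. *)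

theory Defs
  imports Main
begin

definition sgraph :: "'a set \<Rightarrow> ('a \<Rightarrow> 'a \<Rightarrow> bool) \<Rightarrow> bool" where
  "sgraph V E \<longleftrightarrow> finite V \<and> (\<forall>u v. E u v \<longrightarrow> u \<in> V \<and> v \<in> V)
     \<and> (\<forall>u v. E u v \<longrightarrow> E v u) \<and> (\<forall>v. \<not> E v v)"

definition walk :: "'a set \<Rightarrow> ('a \<Rightarrow> 'a \<Rightarrow> bool) \<Rightarrow> 'a list \<Rightarrow> bool" where
  "walk V E xs \<longleftrightarrow> xs \<noteq> [] \<and> set xs \<subseteq> V \<and> (\<forall>i. Suc i < length xs \<longrightarrow> E (xs ! i) (xs ! Suc i))"

definition connected_graph :: "'a set \<Rightarrow> ('a \<Rightarrow> 'a \<Rightarrow> bool) \<Rightarrow> bool" where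
  "connected_graph V E \<longleftrightarrow> V \<noteq> {} \<and>
     (\<forall>x\<in>V. \<forall>y\<in>V. \<exists>xs. walk V E xs \<and> hd xs = x \<and> last xs = y)"

definition gdist :: "'a set \<Rightarrow> ('a \<Rightarrow> 'a \<Rightarrow> bool) \<Rightarrow> 'a \<Rightarrow> 'a \<Rightarrow> nat" where
  "gdist V E x y = (LEAST n. \<exists>xs. walk V E xs \<and> hd xs = x \<and> last xs = y \<and> length xs = Suc n)"

definition local_resolving_set :: "'a set \<Rightarrow> ('a \<Rightarrow> 'a \<Rightarrow> bool) \<Rightarrow> 'a set \<Rightarrow> bool" where
  "local_resolving_set V E W \<longleftrightarrow> W \<subseteq> V \<and>
     (\<forall>u\<in>V - W. \<forall>v\<in>V - W. E u v \<longrightarrow> (\<exists>w\<in>W. gdist V E u w \<noteq> gdist V E v w))"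

definition local_metric_dim :: "'a set \<Rightarrow> ('a \<Rightarrow> 'a \<Rightarrow> bool) \<Rightarrow> nat" where
  "local_metric_dim V E = Min (card ` {W. local_resolving_set V E W})"

definition is_clique :: "('a \<Rightarrow> 'a \<Rightarrow> bool) \<Rightarrow> 'a set \<Rightarrow> bool" where
  "is_clique E K \<longleftrightarrow> (\<forall>u\<in>K. \<forall>v\<in>K. u \<noteq> v \<longrightarrow> E u v)"

definition clique_number :: "'a set \<Rightarrow> ('a \<Rightarrow> 'a \<Rightarrow> bool) \<Rightarrow> nat" where
  "clique_number V E = Max (card ` {K. K \<subseteq> V \<and> is_clique E K})"

definition graph_iso :: "'a set \<Rightarrow> ('a \<Rightarrow> 'a \<Rightarrow> bool) \<Rightarrow> 'b set \<Rightarrow> ('b \<Rightarrow> 'b \<Rightarrow> bool) \<Rightarrow> bool" where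
  "graph_iso V E V' E' \<longleftrightarrow> (\<exists>f. bij_betw f V V' \<and> (\<forall>u\<in>V. \<forall>v\<in>V. E u v \<longleftrightarrow> E' (f u) (f v)))"

definition has_induced :: "'a set \<Rightarrow> ('a \<Rightarrow> 'a \<Rightarrow> bool) \<Rightarrow> 'b set \<Rightarrow> ('b \<Rightarrow> 'b \<Rightarrow> bool) \<Rightarrow> bool" where
  "has_induced V E V' E' \<longleftrightarrow> (\<exists>S \<subseteq> V. graph_iso S (\<lambda>u v. u \<in> S \<and> v \<in> S \<and> E u v) V' E')"

definition Gamma1_E :: "nat \<Rightarrow> nat \<Rightarrow> bool" where
  "Gamma1_E i j \<longleftrightarrow> i \<in> {1..6} \<and> j \<in> {1..6} \<and>
     ((i \<noteq> j \<and> i \<in> {1..4} \<and> j \<in> {1..4}) \<or>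
      {i, j} = {1, 5} \<or> {i, j} = {1, 6} \<or> {i, j} = {2, 5} \<or> {i, j} = {3, 6})"

definition Gamma2_E :: "nat \<Rightarrow> nat \<Rightarrow> bool" where
  "Gamma2_E i j \<longleftrightarrow> Gamma1_E i j \<or> {i, j} = {5, 6}"

definition C5_E :: "nat \<Rightarrow> nat \<Rightarrow> bool" where
  "C5_E i j \<longleftrightarrow> i < 5 \<and> j < 5 \<and> (j = (i + 1) mod 5 \<or> i = (j + 1) mod 5)"

text \<open>K_n^-(lambda,mu) on vertices 0..n-1: K_n minus all edges between
  A = {0..<lambda} and B = {lambda..<lambda+mu}.\<close>
definition Kminus_E :: "nat \<Rightarrow> nat \<Rightarrow> nat \<Rightarrow> nat \<Rightarrow> nat \<Rightarrow> bool" where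
  "Kminus_E n lam mu i j \<longleftrightarrow> i < n \<and> j < n \<and> i \<noteq> j \<and>
     \<not> ((i < lam \<and> lam \<le> j \<and> j < lam + mu) \<or> (j < lam \<and> lam \<le> i \<and> i < lam + mu))"

end

theory Submission
  imports Defs
begin

text \<open>
  Call a vertex set S good if every two adjacent vertices of S are distinguished by a vertex
  outside S. Then the local metric dimension is n - 3 iff there is a good set of size 3 but none of
  size 4. True twins have equal distances to all other vertices, so a pigeonhole argument over twin
  classes excludes good sets of size 4 in the listed graphs.

  Conversely, let there be no good set of size 4. Induced copies of the graphs Gamma are excluded
  because their central clique is good, and a clique of size n - 1 excludes good sets of size 3.
  If every clique has size at most n - 3, looking at distance layers shows that the diameter is at
  most 2, so that distances only see adjacency. In the complement, this means that no edge is
  dominating; moreover the complement is triangle-free, and explicit good sets show that a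
  4-vertex path on three edges can only be part of a 5-cycle exhausting the graph and that two
  disjoint edges are always joined by an edge. Hence the complement is a 5-cycle or a complete
  bipartite graph plus isolated vertices.
\<close>

section \<open>Distances and good sets\<close>

text \<open>Goodness constrains only adjacent pairs, so a complement edge inside a set is free.
  Every configuration is refuted by four vertices such that any two of them adjacent in
  \<open>E\<close> see some outside vertex differently. The obstacle is that witnesses must lie
  outside the set, and small configurations have too few; a five-cycle leaves one witness per
  four-set, which is why it survives as a sporadic case. Missing witnesses come from the clique
  number: if it is at most n - 3, deleting any two vertices leaves a nonadjacent pair, so some
  complement edge avoids any two chosen vertices. Choosing these two to cover the edges of a
  configuration forces new vertices into play. This also gives the bound 2 on both parts of the
  bipartite graph, since a star is covered by its centre; the strict bound on the sum of the parts
  reflects that no complement edge is dominating.\<close>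

locale conn_graph =
  fixes V :: "'a set" and E :: "'a \<Rightarrow> 'a \<Rightarrow> bool"
  assumes sg: "sgraph V E" and con: "connected_graph V E"
begin

lemma fin: "finite V" using sg by (simp add: sgraph_def)
lemma EV: "E u v \<Longrightarrow> u \<in> V" "E u v \<Longrightarrow> v \<in> V" using sg unfolding sgraph_def by blast+
lemma E_sym: "E u v \<Longrightarrow> E v u" using sg unfolding sgraph_def by blast
lemma E_comm: "E u v = E v u" using E_sym by blast
lemma E_irr: "\<not> E v v" using sg unfolding sgraph_def by blast

abbreviation d where "d \<equiv> gdist V E"

lemma walk_iff_relpow:
  assumes "x \<in> V"
  shows "(\<exists>xs. walk V E xs \<and> hd xs = x \<and> last xs = y \<and> length xs = Suc n)
     \<longleftrightarrow> (x, y) \<in> {(u, v). E u v} ^^ n"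
proof
  assume "\<exists>xs. walk V E xs \<and> hd xs = x \<and> last xs = y \<and> length xs = Suc n"
  then obtain xs where xs: "walk V E xs" "hd xs = x" "last xs = y" "length xs = Suc n" by blast
  show "(x, y) \<in> {(u, v). E u v} ^^ n"
    unfolding relpow_fun_conv
  proof (intro exI[of _ "\<lambda>i. xs ! i"] conjI allI impI)
    show "xs ! 0 = x" using xs by (cases xs) auto
    show "xs ! n = y" using xs by (metis diff_Suc_1 last_conv_nth list.size(3) nat.simps(3))
  qed (use xs in \<open>auto simp: walk_def\<close>)
next
  assume "(x, y) \<in> {(u, v). E u v} ^^ n"
  then obtain f where f: "f 0 = x" "f n = y" "\<And>i. i < n \<Longrightarrow> E (f i) (f (Suc i))"
    unfolding relpow_fun_conv by auto
  define xs where "xs = map f [0..<Suc n]"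
  have nth: "xs ! i = f i" if "i < Suc n" for i
    using that unfolding xs_def by (metis add_0 diff_zero length_upt nth_map nth_upt)
  have "f i \<in> V" if "i < Suc n" for i
    using that f assms EV(2)[OF f(3)] by (cases i) auto
  then have "set xs \<subseteq> V" unfolding xs_def by auto
  moreover have len: "length xs = Suc n" unfolding xs_def by simp
  moreover have "xs \<noteq> []" using len by auto
  moreover have "hd xs = x" using nth[of 0] f(1) \<open>xs \<noteq> []\<close> by (simp add: hd_conv_nth)
  moreover have "last xs = y" using nth[of n] f(2) \<open>xs \<noteq> []\<close> len by (simp add: last_conv_nth)
  ultimately show "\<exists>xs. walk V E xs \<and> hd xs = x \<and> last xs = y \<and> length xs = Suc n"
    using f(3) nth unfolding walk_def by (intro exI[of _ xs]) auto
qed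

lemma d_eq: "x \<in> V \<Longrightarrow> d x y = (LEAST n. (x, y) \<in> {(u, v). E u v} ^^ n)"
  unfolding gdist_def by (simp add: walk_iff_relpow)

lemma d_relpow:
  assumes "x \<in> V" "y \<in> V" shows "(x, y) \<in> {(u, v). E u v} ^^ d x y"
proof -
  obtain xs where xs: "walk V E xs" "hd xs = x" "last xs = y"
    using con assms unfolding connected_graph_def by blast
  then have "length xs = Suc (length xs - 1)" by (auto simp: walk_def)
  with xs have "\<exists>n. (x, y) \<in> {(u, v). E u v} ^^ n"
    using walk_iff_relpow[OF assms(1)] by metis
  then show ?thesis unfolding d_eq[OF assms(1)] by (rule LeastI_ex)
qed

lemma d_le: "x \<in> V \<Longrightarrow> (x, y) \<in> {(u, v). E u v} ^^ n \<Longrightarrow> d x y \<le> n"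
  unfolding d_eq by (rule Least_le)

lemma d_self [simp]: "x \<in> V \<Longrightarrow> d x x = 0"
  using d_le[of x x 0] by auto

lemma d_0: "x \<in> V \<Longrightarrow> y \<in> V \<Longrightarrow> d x y = 0 \<longleftrightarrow> x = y"
  using d_relpow[of x y] by (cases "d x y") auto

lemma d_step: assumes "E u v" "x \<in> V" shows "d u x \<le> Suc (d v x)"
proof -
  have "(v, x) \<in> {(u, v). E u v} ^^ d v x" using d_relpow assms EV by blast
  then have "(u, x) \<in> {(u, v). E u v} ^^ Suc (d v x)"
    using assms(1) by (intro relpow_Suc_I2) auto
  then show ?thesis using d_le EV assms by blast
qed

lemma d_pred: assumes "u \<in> V" "x \<in> V" "d u x = Suc k" obtains v where "E u v" "d v x = k"
proof -
  have "(u, x) \<in> {(u, v). E u v} ^^ Suc k" using d_relpow assms by metis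
  then obtain v where v: "E u v" "(v, x) \<in> {(u, v). E u v} ^^ k"
    using relpow_Suc_D2 by fast
  have "d v x \<le> k" using d_le v EV by blast
  moreover have "Suc k \<le> Suc (d v x)" using d_step[OF v(1) assms(2)] assms(3) by simp
  ultimately show thesis using that v(1) by (metis Suc_le_mono le_antisym)
qed

lemma d_1: assumes "x \<in> V" "y \<in> V" shows "d x y = 1 \<longleftrightarrow> E x y"
proof
  assume "d x y = 1"
  then obtain v where "E x v" "d v y = 0" using d_pred[of x y 0] assms by auto
  then show "E x y" using d_0 EV assms by metis
next
  assume "E x y"
  then have "d x y \<le> 1" using d_step[of x y y] assms by simp
  moreover have "d x y \<noteq> 0" using \<open>E x y\<close> d_0 assms E_irr by metis
  ultimately show "d x y = 1" by simp
qed

lemma d_2: assumes "x \<in> V" "y \<in> V"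
  shows "d x y = 2 \<longleftrightarrow> x \<noteq> y \<and> \<not> E x y \<and> (\<exists>z. E x z \<and> E z y)"
proof
  assume A: "d x y = 2"
  then obtain v where "E x v" "d v y = 1" using d_pred[of x y 1] assms by auto
  then have "E x v \<and> E v y" using d_1 EV assms by metis
  then show "x \<noteq> y \<and> \<not> E x y \<and> (\<exists>z. E x z \<and> E z y)"
    using A d_0[OF assms] d_1[OF assms] by auto
next
  assume A: "x \<noteq> y \<and> \<not> E x y \<and> (\<exists>z. E x z \<and> E z y)"
  then obtain z where z: "E x z" "E z y" by blast
  have "d z y = 1" using d_1 z EV assms by blast
  then have "d x y \<le> 2" using d_step[OF z(1) assms(2)] by simp
  moreover have "d x y \<noteq> 0" "d x y \<noteq> 1" using A d_0 d_1 assms by auto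
  ultimately show "d x y = 2" by linarith
qed

text \<open>Let a shortest walk from \<open>u\<close> to \<open>w\<close> continue with
  \<open>u'\<close>. If \<open>u'\<close> is \<open>v\<close>, then \<open>v\<close> is even closer
  to \<open>w\<close>; otherwise \<open>u'\<close> is a neighbour of \<open>v\<close> too, and
  exchanging the first vertex keeps the length.\<close>

lemma twins_same_dist_aux:
  assumes "E u v" "\<And>w. w \<in> V - {u, v} \<Longrightarrow> E u w = E v w" "w \<in> V - {u, v}"
  shows "d v w \<le> d u w"
proof -
  have V: "u \<in> V" "v \<in> V" using EV assms by auto
  obtain k where k: "d u w = Suc k" using d_0[of u w] V assms(3) by (cases "d u w") auto
  then obtain u' where u': "E u u'" "d u' w = k" using d_pred V assms(3) by blast
  show ?thesis
  proof (cases "u' = v")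
    case True then show ?thesis using u' k by simp
  next
    case False
    then have "E v u'" using assms(2)[of u'] u' EV E_irr by blast
    then show ?thesis using d_step[of v u' w] u' k assms(3) by simp
  qed
qed

lemma twins_same_dist:
  assumes "E u v" "\<And>w. w \<in> V - {u, v} \<Longrightarrow> E u w = E v w" "w \<in> V - {u, v}"
  shows "d u w = d v w"
  using twins_same_dist_aux[OF assms] twins_same_dist_aux[of v u w] assms E_sym
  by (metis insert_commute le_antisym)

section \<open>Good sets, local metric dimension and cliques\<close>

definition good :: "'a set \<Rightarrow> bool" where
  "good S \<longleftrightarrow> (\<forall>u\<in>S. \<forall>v\<in>S. E u v \<longrightarrow> (\<exists>w\<in>V - S. d u w \<noteq> d v w))"

lemma good_mono: "good S \<Longrightarrow> T \<subseteq> S \<Longrightarrow> good T"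
  unfolding good_def by blast

lemma local_resolving_iff: "local_resolving_set V E W \<longleftrightarrow> W \<subseteq> V \<and> good (V - W)"
  unfolding local_resolving_set_def good_def by (auto simp: double_diff)

text \<open>Local resolving sets are the complements of good sets. A good set can be shrunk to any
  smaller size, because deleting a vertex only adds possible witnesses; so exactly \<open>k\<close>
  vertices suffice.\<close>

lemma dim_le_iff:
  assumes "k \<le> card V"
  shows "local_metric_dim V E \<le> card V - k \<longleftrightarrow> (\<exists>S\<subseteq>V. card S = k \<and> good S)"
proof -
  let ?A = "card ` {W. local_resolving_set V E W}"
  have "?A \<subseteq> card ` Pow V" by (auto simp: local_resolving_iff)
  then have "finite ?A" using fin finite_subset by blast
  moreover have "local_resolving_set V E V" by (simp add: local_resolving_iff good_def)
  ultimately have "local_metric_dim V E \<le> card V - k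
      \<longleftrightarrow> (\<exists>W. local_resolving_set V E W \<and> card W \<le> card V - k)"
    unfolding local_metric_dim_def by (subst Min_le_iff) auto
  also have "\<dots> \<longleftrightarrow> (\<exists>S\<subseteq>V. card S = k \<and> good S)"
  proof
    assume "\<exists>W. local_resolving_set V E W \<and> card W \<le> card V - k"
    then obtain W where W: "W \<subseteq> V" "good (V - W)" "card W \<le> card V - k"
      by (auto simp: local_resolving_iff)
    then have "k \<le> card (V - W)"
      using assms fin by (simp add: card_Diff_subset finite_subset)
    then obtain S where "S \<subseteq> V - W" "card S = k" by (meson obtain_subset_with_card_n)
    then show "\<exists>S\<subseteq>V. card S = k \<and> good S" using W good_mono by blast
  next
    assume "\<exists>S\<subseteq>V. card S = k \<and> good S"
    then obtain S where S: "S \<subseteq> V" "card S = k" "good S" by blast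
    then have "local_resolving_set V E (V - S)" by (simp add: local_resolving_iff double_diff)
    moreover have "card (V - S) = card V - k" using S fin by (simp add: card_Diff_subset finite_subset)
    ultimately show "\<exists>W. local_resolving_set V E W \<and> card W \<le> card V - k" by auto
  qed
  finally show ?thesis .
qed

lemma dim_eq_iff:
  assumes "5 \<le> card V"
  shows "local_metric_dim V E = card V - 3 \<longleftrightarrow>
    (\<exists>S\<subseteq>V. card S = 3 \<and> good S) \<and> \<not> (\<exists>S\<subseteq>V. card S = 4 \<and> good S)"
  using dim_le_iff[of 3] dim_le_iff[of 4] assms by auto

lemma clique_number_ge: "K \<subseteq> V \<Longrightarrow> is_clique E K \<Longrightarrow> card K \<le> clique_number V E"
  unfolding clique_number_def using fin by (intro Max_ge) auto

lemma clique_number_attained: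
  obtains K where "K \<subseteq> V" "is_clique E K" "card K = clique_number V E"
proof -
  have "clique_number V E \<in> card ` {K. K \<subseteq> V \<and> is_clique E K}"
    unfolding clique_number_def using fin
    by (intro Max_in) (auto simp: is_clique_def intro: exI[of _ "{}"])
  then show thesis using that by auto
qed

lemma clique_of_card:
  assumes "k \<le> clique_number V E"
  obtains K where "K \<subseteq> V" "is_clique E K" "card K = k"
proof -
  obtain K where K: "K \<subseteq> V" "is_clique E K" "card K = clique_number V E"
    using clique_number_attained .
  then obtain K' where "K' \<subseteq> K" "card K' = k" using assms by (metis obtain_subset_with_card_n)
  then show thesis using K that[of K'] unfolding is_clique_def by blast
qed

lemma good4_iff_cases:
  "good {a,b,c,e} \<longleftrightarrow> (E a b \<longrightarrow> (\<exists>w\<in>V - {a,b,c,e}. d a w \<noteq> d b w))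
    \<and> (E a c \<longrightarrow> (\<exists>w\<in>V - {a,b,c,e}. d a w \<noteq> d c w))
    \<and> (E a e \<longrightarrow> (\<exists>w\<in>V - {a,b,c,e}. d a w \<noteq> d e w))
    \<and> (E b c \<longrightarrow> (\<exists>w\<in>V - {a,b,c,e}. d b w \<noteq> d c w))
    \<and> (E b e \<longrightarrow> (\<exists>w\<in>V - {a,b,c,e}. d b w \<noteq> d e w))
    \<and> (E c e \<longrightarrow> (\<exists>w\<in>V - {a,b,c,e}. d c w \<noteq> d e w))"
  unfolding good_def ball_simps using E_comm E_irr
  by (smt (verit, best))

lemma goodI3:
  assumes "E a b \<Longrightarrow> \<exists>w\<in>V - {a,b,c}. d a w \<noteq> d b w"
    and "E a c \<Longrightarrow> \<exists>w\<in>V - {a,b,c}. d a w \<noteq> d c w"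
    and "E b c \<Longrightarrow> \<exists>w\<in>V - {a,b,c}. d b w \<noteq> d c w"
  shows "good {a,b,c}"
  unfolding good_def using assms E_comm E_irr
  by (smt (verit, best) empty_iff insert_iff)

lemma adj_dist: "u \<in> V \<Longrightarrow> v \<in> V \<Longrightarrow> w \<in> V \<Longrightarrow> E u w \<noteq> E v w \<Longrightarrow> d u w \<noteq> d v w"
  using d_1 by metis

end

section \<open>No good set of size four: diameter two\<close>

text \<open>\<open>tau\<close>: the complement has no vertex cover of size two.\<close>

locale no_good4 = conn_graph +
  assumes no4: "S \<subseteq> V \<Longrightarrow> card S = 4 \<Longrightarrow> \<not> good S"
    and tau: "\<exists>u v. u \<in> V - {p, q} \<and> v \<in> V - {p, q} \<and> u \<noteq> v \<and> \<not> E u v"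
begin

lemma bad4_dist:
  assumes "a \<in> V" "b \<in> V" "c \<in> V" "e \<in> V" "distinct [a, b, c, e]"
  shows "(E a b \<and> (\<forall>w\<in>V - {a,b,c,e}. d a w = d b w)) \<or> (E a c \<and> (\<forall>w\<in>V - {a,b,c,e}. d a w = d c w))
    \<or> (E a e \<and> (\<forall>w\<in>V - {a,b,c,e}. d a w = d e w)) \<or> (E b c \<and> (\<forall>w\<in>V - {a,b,c,e}. d b w = d c w))
    \<or> (E b e \<and> (\<forall>w\<in>V - {a,b,c,e}. d b w = d e w)) \<or> (E c e \<and> (\<forall>w\<in>V - {a,b,c,e}. d c w = d e w))"
  using no4[of "{a,b,c,e}"] assms unfolding good4_iff_cases by simp

lemma ex_at_dist:
  assumes "v \<in> V" "x \<in> V" "k \<le> d v x" shows "\<exists>u\<in>V. d u x = k"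
proof -
  have "\<exists>u\<in>V. d u x = n - j" if "d v x = n" "j \<le> n" for n j
    using that(2)
  proof (induction j)
    case 0 then show ?case using that assms by auto
  next
    case (Suc j)
    then obtain u where "u \<in> V" "d u x = n - j" by auto
    then have "d u x = Suc (n - Suc j)" using Suc by simp
    then show ?case using d_pred \<open>u \<in> V\<close> assms EV by metis
  qed
  from this[of "d v x" "d v x - k"] show ?thesis using assms(3) by auto
qed

text \<open>Otherwise take one vertex at each of the distances 1, 2, 3, 4 from \<open>x\<close>. The
  vertex \<open>x\<close> lies outside and separates all of them, so they form a good set.\<close>

lemma dist_le_3: assumes "v \<in> V" "x \<in> V" shows "d v x \<le> 3"
proof (rule ccontr)
  assume "\<not> d v x \<le> 3"
  then obtain p q r s where *: "p \<in> V" "q \<in> V" "r \<in> V" "s \<in> V"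
    "d p x = 1" "d q x = 2" "d r x = 3" "d s x = 4"
    using ex_at_dist[OF assms, of 1] ex_at_dist[OF assms, of 2] ex_at_dist[OF assms, of 3]
      ex_at_dist[OF assms, of 4] by auto
  then have "distinct [p, q, r, s]" and "x \<in> V - {p, q, r, s}" using assms by auto
  moreover from this(2) have "\<exists>w\<in>V - {p, q, r, s}. d p w \<noteq> d q w"
    "\<exists>w\<in>V - {p, q, r, s}. d p w \<noteq> d r w" "\<exists>w\<in>V - {p, q, r, s}. d p w \<noteq> d s w"
    "\<exists>w\<in>V - {p, q, r, s}. d q w \<noteq> d r w" "\<exists>w\<in>V - {p, q, r, s}. d q w \<noteq> d s w"
    "\<exists>w\<in>V - {p, q, r, s}. d r w \<noteq> d s w"
    by (rule_tac[!] bexI[of _ x]) (simp_all add: *)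
  ultimately show False using bad4_dist[OF *(1-4)] by blast
qed

text \<open>If some vertex has distance 3 from \<open>x\<close>, the layers around \<open>x\<close>
  are cliques, and a layer with two vertices is completely joined to the next layer towards
  \<open>x\<close>. Unless \<open>L 1\<close> and \<open>L 3\<close> both have two vertices, all but
  two vertices of the graph form a clique, against \<open>tau\<close>.\<close>

lemma dist_le_2: assumes x: "x \<in> V" and y0: "y0 \<in> V" shows "d y0 x \<le> 2"
proof (rule ccontr)
  assume "\<not> d y0 x \<le> 2"
  then have y0d: "d y0 x = 3" using dist_le_3 assms by (metis le_SucE le_antisym numeral_2_eq_2 numeral_3_eq_3)
  define L where "L i = {v \<in> V. d v x = i}" for i
  have LV: "v \<in> V" if "v \<in> L i" for v i using that by (simp add: L_def)
  have Ld: "d v x = i" if "v \<in> L i" for v i using that by (simp add: L_def)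
  have Lx: "v \<noteq> x" if "v \<in> L i" "0 < i" for v i using that x by (auto simp: L_def)
  have cover: "v = x \<or> v \<in> L 1 \<or> v \<in> L 2 \<or> v \<in> L 3" if "v \<in> V" for v
  proof -
    have "d v x = 0 \<or> d v x = 1 \<or> d v x = 2 \<or> d v x = 3" using dist_le_3[OF that x] by linarith
    then show ?thesis using that d_0[OF that x] by (auto simp: L_def)
  qed
  have L1: "E v x" if "v \<in> L 1" for v using that d_1 x LV Ld by blast
  have ne: "\<exists>v. v \<in> L 1" "\<exists>v. v \<in> L 2" "\<exists>v. v \<in> L 3"
    using ex_at_dist[OF y0 x, of 1] ex_at_dist[OF y0 x, of 2] ex_at_dist[OF y0 x, of 3] y0d
    by (auto simp: L_def)
  have far: "\<not> E u v" if "u \<in> L i" "v \<in> L j" "Suc i < j" for u v i j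
    using d_step[of v u x] E_sym[of u v] x that by (auto simp: L_def)
  have farx: "\<not> E v x" if "v \<in> L i" "1 < i" for v i
    using d_1[of v x] x that by (auto simp: L_def)
  have down: "\<exists>u\<in>L i. E v u" if "v \<in> L (Suc i)" for v i
    using that d_pred[of v x i] x EV by (metis (mono_tags, lifting) L_def mem_Collect_eq)
  text \<open>Since x separates vertices of different layers, only the two vertices v, v' of the
    same layer can be the undistinguished pair.\<close>
  have key: "E v v' \<and> (\<forall>w\<in>V - {v, v', p, q}. d v w = d v' w)"
    if "v \<in> L i" "v' \<in> L i" "v \<noteq> v'" "p \<in> L j" "q \<in> L k" "i \<noteq> j" "i \<noteq> k" "j \<noteq> k"
      "0 < i" "0 < j" "0 < k" for v v' p q i j k
  proof -
    have dd: "d v x = i" "d v' x = i" "d p x = j" "d q x = k"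
      and VV: "v \<in> V" "v' \<in> V" "p \<in> V" "q \<in> V"
      using that by (auto simp: L_def)
    have xn: "x \<in> V - {v, v', p, q}" using x that Lx by blast
    have dist: "distinct [v, v', p, q]" using dd that by auto
    have "\<exists>w\<in>V - {v, v', p, q}. d v w \<noteq> d p w" "\<exists>w\<in>V - {v, v', p, q}. d v w \<noteq> d q w"
      "\<exists>w\<in>V - {v, v', p, q}. d v' w \<noteq> d p w" "\<exists>w\<in>V - {v, v', p, q}. d v' w \<noteq> d q w"
      "\<exists>w\<in>V - {v, v', p, q}. d p w \<noteq> d q w"
      using xn dd that by metis+
    then show ?thesis using bad4_dist[OF VV dist] by meson
  qed
  obtain a0 b0 c0 where abc0: "a0 \<in> L 1" "b0 \<in> L 2" "c0 \<in> L 3" using ne by blast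
  have cl1: "E v v'" if "v \<in> L 1" "v' \<in> L 1" "v \<noteq> v'" for v v'
    using key[OF that abc0(2,3)] by simp
  have cl2: "E v v'" if "v \<in> L 2" "v' \<in> L 2" "v \<noteq> v'" for v v'
    using key[OF that abc0(1,3)] by simp
  have cl3: "E v v'" if "v \<in> L 3" "v' \<in> L 3" "v \<noteq> v'" for v v'
    using key[OF that abc0(1,2)] by simp
  \<comment> \<open>Putting \<open>w2\<close> into the four-set as the representative of layer
    \<open>j\<close> leaves \<open>w\<close> outside, where \<open>key\<close> applies to it. So in
    a layer with two vertices, each vertex is adjacent to all of layer \<open>i\<close> or to
    none.\<close>
  have F: "E v w = E v' w"
    if "v \<in> L i" "v' \<in> L i" "w \<in> L j" "w2 \<in> L j" "w \<noteq> w2" "q \<in> L k"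
      "i \<noteq> j" "i \<noteq> k" "j \<noteq> k" "0 < i" "0 < j" "0 < k" for v v' w w2 q i j k
  proof (cases "v = v'")
    case False
    have "w \<in> V - {v, v', w2, q}" using that by (auto simp: L_def)
    then have "d v w = d v' w" using key[of v i v' w2 j q k] that False by blast
    then show ?thesis using d_1 LV that by metis
  qed simp
  have c12: "E v w" if "v \<in> L 1" "w \<in> L 2" "w2 \<in> L 2" "w \<noteq> w2" for v w w2
  proof -
    have "w \<in> L (Suc 1)" using that by (simp add: numeral_2_eq_2)
    then obtain u where "u \<in> L 1" "E w u" using down by blast
    then show ?thesis using F[of v 1 u w 2 w2 c0 3] that abc0 E_sym by auto
  qed
  have c23: "E v w" if "v \<in> L 2" "w \<in> L 3" "w2 \<in> L 3" "w \<noteq> w2" for v w w2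
  proof -
    have "w \<in> L (Suc 2)" using that by (simp add: numeral_3_eq_3 numeral_2_eq_2)
    then obtain u where "u \<in> L 2" "E w u" using down by blast
    then show ?thesis using F[of v 2 u w 3 w2 a0 1] that abc0 E_sym by auto
  qed
  show False
  proof (cases "\<exists>y y'. y \<in> L 3 \<and> y' \<in> L 3 \<and> y \<noteq> y'")
    case False
    then have L3: "v = c0" if "v \<in> L 3" for v using that abc0 by blast
    show False
    proof (cases "\<exists>b b'. b \<in> L 2 \<and> b' \<in> L 2 \<and> b \<noteq> b'")
      case True
      then have all: "E v w" if "v \<in> L 1" "w \<in> L 2" for v w using c12 that by metis
      \<comment> \<open>\<open>L 1\<close> and \<open>L 2\<close> together form a clique and contain
        all vertices except \<open>x\<close> and \<open>c0\<close>.\<close>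
      obtain u v where "u \<in> V - {x, c0}" "v \<in> V - {x, c0}" "u \<noteq> v" "\<not> E u v" using tau by blast
      then show False using all cl1 cl2 cover L3 E_sym
        by (metis Diff_iff insert_iff)
    next
      case False
      then have L2: "v = b0" if "v \<in> L 2" for v using that abc0 by blast
      obtain u v where "u \<in> V - {b0, c0}" "v \<in> V - {b0, c0}" "u \<noteq> v" "\<not> E u v" using tau by blast
      then show False using cl1 cover L1 L3 L2 E_sym
        by (metis Diff_iff insert_iff)
    qed
  next
    case True
    then have all23: "E v w" if "v \<in> L 2" "w \<in> L 3" for v w using c23 that by metis
    from True obtain y' where y': "y' \<in> L 3" "c0 \<noteq> y'" by metis
    show False
    proof (cases "\<exists>a a'. a \<in> L 1 \<and> a' \<in> L 1 \<and> a \<noteq> a'")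
      case False
      then have L1': "v = a0" if "v \<in> L 1" for v using that abc0 by blast
      obtain u v where "u \<in> V - {x, a0}" "v \<in> V - {x, a0}" "u \<noteq> v" "\<not> E u v" using tau by blast
      then show False using all23 cl2 cl3 cover L1' E_sym
        by (metis Diff_iff insert_iff)
    next
      \<comment> \<open>Now \<open>{x, a, b0, c0}\<close> is good: only consecutive members are
        adjacent, \<open>y'\<close> separates the first two of these pairs, and \<open>a'\<close>
        separates the last one.\<close>
      case two1: True
      have "b0 \<in> L (Suc 1)" using abc0 by (simp add: numeral_2_eq_2)
      then obtain a where a: "a \<in> L 1" "E b0 a" using down by blast
      then obtain a' where a': "a' \<in> L 1" "a \<noteq> a'" using two1 by metis
      have mem: "x \<in> V" "a \<in> V" "b0 \<in> V" "c0 \<in> V" using x LV a abc0 by blast+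
      have dst: "distinct [x, a, b0, c0]"
        using Ld[OF a(1)] Ld[OF abc0(2)] Ld[OF abc0(3)] x by auto
      have y'out: "y' \<in> V - {x, a, b0, c0}" 
        using Ld[OF y'(1)] Ld[OF a(1)] Ld[OF abc0(2)] y' x LV[OF y'(1)] by auto
      have a'out: "a' \<in> V - {x, a, b0, c0}" 
        using Ld[OF a'(1)] Ld[OF abc0(3)] Ld[OF abc0(2)] a' x LV[OF a'(1)] by auto
      have nb: "\<not> E b0 x" "\<not> E c0 x" "\<not> E a c0" using farx abc0 far[of a 1 c0 3] a by auto
      have ab: "d a y' \<noteq> d b0 y'"
        using all23[OF abc0(2) y'(1)] far[of a 1 y' 3] a y' adj_dist y'out mem by auto
      have "d x y' \<noteq> 2"
      proof
        assume "d x y' = 2"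
        then obtain z where z: "E x z" "E z y'" using d_2[OF x, of y'] y'out by blast
        have "z \<in> L 1" using d_1[of z x] z EV E_sym x by (auto simp: L_def)
        then show False using far[of z 1 y' 3] z y' by simp
      qed
      moreover have "d a y' = 2"
        using d_2[of a y'] mem y'out a all23[OF abc0(2) y'(1)] far[of a 1 y' 3] y' E_sym by auto
      ultimately have xa: "d x y' \<noteq> d a y'" by simp
      have a'c: "\<not> E c0 a'" using far[of a' 1 c0 3] a' abc0 E_sym by auto
      have bc: "d b0 a' \<noteq> d c0 a'"
      proof (cases "E b0 a'")
        case True
        then show ?thesis using a'c adj_dist a'out mem by blast
      next
        case False
        have "d b0 a' = 2" using d_2[of b0 a'] False cl1[OF a(1) a'] a a'out mem by auto
        \<comment> \<open>A common neighbour would lie in \<open>L 2\<close> and differ from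
          \<open>b0\<close>; then \<open>L 2\<close> has two vertices, which makes \<open>b0\<close>
          adjacent to \<open>a'\<close> after all.\<close>
        moreover have "d c0 a' \<noteq> 2"
        proof
          assume "d c0 a' = 2"
          then obtain z where z: "E c0 z" "E z a'" using d_2[of c0 a'] a'out mem by blast
          have "z \<in> L 2" using cover[OF EV(2)[OF z(1)]] z nb(2) far[of z 1 c0 3] far[of a' 1 z 3]
              abc0 a' E_sym by auto
          moreover have "E z' a'" if "z' \<in> L 2" "z' \<noteq> b0" for z'
            using c12[OF a'(1) that(1) abc0(2)] that E_sym by blast
          ultimately show False
            using False c12[OF a'(1) abc0(2)] E_sym z by metis
        qed
        ultimately show ?thesis by simp
      qed
      show False
        using bad4_dist[OF mem dst] ab xa bc nb y'out a'out E_comm by metis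
    qed
  qed
qed

lemma common_nbr:
  assumes "u \<in> V" "v \<in> V" "u \<noteq> v" "\<not> E u v" obtains z where "E u z" "E v z"
proof -
  have "d u v = 2" using dist_le_2[OF assms(2,1)] d_0[OF assms(1,2)] d_1[OF assms(1,2)] assms
    by (auto simp: le_Suc_eq numeral_2_eq_2)
  then show thesis using d_2 assms that E_sym by blast
qed

section \<open>The complement graph\<close>

text \<open>Equal distances to \<open>w\<close> give equal adjacency to \<open>w\<close>; in
  diameter two no information is lost this way.\<close>

lemma bad4_adj:
  assumes "a \<in> V" "b \<in> V" "c \<in> V" "e \<in> V" "distinct [a, b, c, e]"
  shows "(E a b \<and> (\<forall>w\<in>V - {a,b,c,e}. E a w = E b w)) \<or> (E a c \<and> (\<forall>w\<in>V - {a,b,c,e}. E a w = E c w))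
    \<or> (E a e \<and> (\<forall>w\<in>V - {a,b,c,e}. E a w = E e w)) \<or> (E b c \<and> (\<forall>w\<in>V - {a,b,c,e}. E b w = E c w))
    \<or> (E b e \<and> (\<forall>w\<in>V - {a,b,c,e}. E b w = E e w)) \<or> (E c e \<and> (\<forall>w\<in>V - {a,b,c,e}. E c w = E e w))"
proof -
  have "\<forall>w\<in>V - {a,b,c,e}. E u w = E v w"
    if "\<forall>w\<in>V - {a,b,c,e}. d u w = d v w" "u \<in> V" "v \<in> V" for u v
    using that adj_dist by blast
  then show ?thesis using bad4_dist[OF assms] assms(1-4) by meson
qed

section \<open>No independent triple, that is, no triangle in the complement\<close>

definition near_twin :: "'a set \<Rightarrow> 'a \<Rightarrow> 'a \<Rightarrow> bool" where
  "near_twin T p v \<longleftrightarrow> v \<in> V - T \<and> E v p \<and> (\<forall>w\<in>V - T - {v}. E v w = E p w)"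

text \<open>If an independent triple \<open>T\<close> together with \<open>v\<close> is not good,
  the offending pair consists of \<open>v\<close> and some \<open>p\<close> in \<open>T\<close>,
  which is what \<open>near_twin T p v\<close> records. Either of two near twins may then be
  replaced by its partner without changing their adjacency.\<close>

lemma near_twin_adj:
  assumes "near_twin T p u" "near_twin T q v" "u \<noteq> v"
  shows "E u v = E p v" "E u v = E u q"
proof -
  show "E u v = E p v" using assms unfolding near_twin_def by blast
  have "E v u = E q u" using assms unfolding near_twin_def by blast
  then show "E u v = E u q" using E_comm by blast
qed

text \<open>Since the near twin \<open>u\<close> of \<open>a\<close> sees the whole triple,
  \<open>a\<close> is adjacent to every vertex outside it. A nonadjacent pair \<open>g\<close>,
  \<open>h\<close> avoiding \<open>b\<close> and \<open>c\<close> therefore consists of a near twin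
  of \<open>b\<close> and one of \<open>c\<close>; then \<open>u\<close>, \<open>g\<close>,
  \<open>h\<close>, \<open>a\<close> show all four adjacency patterns to \<open>b\<close>,
  \<open>c\<close> and form a good set.\<close>

lemma independent_triple_aux:
  assumes V: "a \<in> V" "b \<in> V" "c \<in> V" and dst: "distinct [a, b, c]"
    and ind: "\<not> E a b" "\<not> E a c" "\<not> E b c"
    and cover: "\<And>v. v \<in> V - {a,b,c} \<Longrightarrow> near_twin {a,b,c} a v \<or> near_twin {a,b,c} b v \<or> near_twin {a,b,c} c v"
    and u: "near_twin {a,b,c} a u" "E u b" "E u c"
  shows False
proof -
  let ?N = "near_twin {a,b,c}"
  have adj_a: "E a v" if "v \<in> V - {a,b,c}" for v
  proof (cases "v = u")
    case True then show ?thesis using u E_sym unfolding near_twin_def by blast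
  next
    case False
    have "?N a v \<Longrightarrow> E a v" using E_sym unfolding near_twin_def by blast
    moreover have "?N b v \<Longrightarrow> E a v" "?N c v \<Longrightarrow> E a v"
      using near_twin_adj[OF u(1) _ False[symmetric]] u by blast+
    ultimately show ?thesis using cover[OF that] by blast
  qed
  have cross: "False" if "?N b g" "?N c h" "\<not> E g h" "g \<noteq> h" for g h
  proof -
    have gh: "\<not> E g c" "\<not> E h b" using near_twin_adj[OF that(1,2,4)] that E_comm by blast+
    have E': "E g b" "E h c" using that unfolding near_twin_def by blast+
    have mem: "u \<in> V" "g \<in> V" "h \<in> V" "a \<in> V" "b \<in> V - {u,g,h,a}" "c \<in> V - {u,g,h,a}"
      using u that V dst unfolding near_twin_def by auto
    have "distinct [u, g, h, a]" using that u gh unfolding near_twin_def by auto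
    from bad4_adj[OF mem(1-4) this] mem(5,6) gh E' u(2,3) ind that(3) show False
      by blast
  qed
  obtain g h where gh: "g \<in> V - {b, c}" "h \<in> V - {b, c}" "g \<noteq> h" "\<not> E g h" using tau by blast
  then have "g \<noteq> a" "h \<noteq> a" using adj_a E_sym by blast+
  then have gh': "g \<in> V - {a,b,c}" "h \<in> V - {a,b,c}" using gh by auto
  have aa: "E a g" "E a h" using adj_a gh' by auto
  have same: False if "?N p g" "?N p h" for p
    using near_twin_adj(2)[OF that gh(3)] that gh(4) unfolding near_twin_def by blast
  have "\<not> ?N a g" "\<not> ?N a h"
    using cover[OF gh'(1)] cover[OF gh'(2)] near_twin_adj[of "{a,b,c}" a g _ h]
      near_twin_adj[of "{a,b,c}" a h _ g] gh(3,4) aa E_comm[of g h] by blast+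
  then show False
    using cover[OF gh'(1)] cover[OF gh'(2)] same cross[of g h] cross[of h g] gh(3,4) E_comm[of g h]
    by blast
qed

lemma no_independent_triple:
  assumes V: "a \<in> V" "b \<in> V" "c \<in> V" and dst: "distinct [a, b, c]"
    and ind: "\<not> E a b" "\<not> E a c" "\<not> E b c"
  shows False
proof -
  let ?N = "near_twin {a,b,c}"
  have cover: "?N a v \<or> ?N b v \<or> ?N c v" if v: "v \<in> V - {a,b,c}" for v
  proof -
    have "distinct [a,b,c,v]" "v \<in> V" using dst v by auto
    note bad = bad4_adj[OF V this(2,1)]
    have V': "V - {a,b,c,v} = V - {a,b,c} - {v}" by blast
    have "?N p v" if "E p v" "\<forall>w\<in>V - {a,b,c,v}. E p w = E v w" for p
      using that v E_sym unfolding near_twin_def V' by blast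
    then show ?thesis using bad ind by blast
  qed
  have ind': "\<not> E b a" "\<not> E c a" "\<not> E c b" using ind E_sym by blast+
  have out: "z \<in> V - {a,b,c}" if "E a z \<and> E b z \<or> E b z \<and> E c z \<or> E a z \<and> E c z" for z
  proof -
    have "z \<in> V" using that EV(2) by blast
    moreover have "z \<noteq> a" "z \<noteq> b" "z \<noteq> c" using that ind ind' E_irr by auto
    ultimately show ?thesis by blast
  qed
  obtain x where x: "E a x" "E b x" using common_nbr V dst ind by auto
  obtain y where y: "E b y" "E c y" using common_nbr V dst ind by auto
  obtain z where z: "E a z" "E c z" using common_nbr V dst ind by auto
  \<comment> \<open>Otherwise \<open>x\<close>, \<open>y\<close>, \<open>z\<close> each miss one
    vertex of the triple. Each is a near twin of one of its two neighbours there, and every choice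
    of these forces two contradictory values for some adjacency among \<open>x\<close>,
    \<open>y\<close>, \<open>z\<close>.\<close>
  have "\<exists>u. E a u \<and> E b u \<and> E c u"
  proof (rule ccontr)
    assume "\<nexists>u. E a u \<and> E b u \<and> E c u"
    then have n: "\<not> E c x" "\<not> E a y" "\<not> E b z" using x y z by auto
    then have ne: "x \<noteq> y" "y \<noteq> z" "x \<noteq> z" using x y z by auto
    have adj: "E v p" if "?N p v" for p v using that unfolding near_twin_def by blast
    have "\<not> ?N c x" "\<not> ?N a y" "\<not> ?N b z"
      using adj n E_sym by blast+
    then have "?N a x \<or> ?N b x" "?N b y \<or> ?N c y" "?N a z \<or> ?N c z"
      using cover[of x] cover[of y] cover[of z] out[of x] out[of y] out[of z] x y z by blast+
    moreover have "\<not> (?N a x \<and> ?N b y)" "\<not> (?N b x \<and> ?N a z)" "\<not> (?N c y \<and> ?N a z)"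
      "\<not> (?N a x \<and> ?N c z)" "\<not> (?N b x \<and> ?N c y)" "\<not> (?N b y \<and> ?N c z)"
      using near_twin_adj[of "{a,b,c}" _ x _ y] near_twin_adj[of "{a,b,c}" _ x _ z]
        near_twin_adj[of "{a,b,c}" _ y _ z] x y z n ne E_comm[of x] E_comm[of y] E_comm[of z]
      by blast+
    ultimately show False by blast
  qed
  then obtain u where u: "E u a" "E u b" "E u c" using E_sym by blast
  then have "?N a u \<or> ?N b u \<or> ?N c u" using cover[of u] out[of u] E_sym by blast
  moreover have perm: "{b,a,c} = {a,b,c}" "{c,a,b} = {a,b,c}" by auto
  ultimately show False
    using independent_triple_aux[of a b c u] independent_triple_aux[of b a c u]
      independent_triple_aux[of c a b u] V dst ind u cover E_comm[of b a] E_comm[of c a] E_comm[of c b]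
    unfolding perm by auto
qed

definition coadj :: "'a \<Rightarrow> 'a \<Rightarrow> bool" where
  "coadj u v \<longleftrightarrow> u \<in> V \<and> v \<in> V \<and> u \<noteq> v \<and> \<not> E u v"

lemma coadj_comm: "coadj u v = coadj v u" unfolding coadj_def using E_sym by blast
lemma coadj_irr: "\<not> coadj v v" unfolding coadj_def by blast
lemma coadj_V: "coadj u v \<Longrightarrow> u \<in> V" "coadj u v \<Longrightarrow> v \<in> V" unfolding coadj_def by blast+
lemma coadj_tri: "coadj u v \<Longrightarrow> coadj v w \<Longrightarrow> \<not> coadj u w"
  using no_independent_triple[of u v w] unfolding coadj_def by (metis distinct_length_2_or_more distinct_singleton)
lemma coadj_nondom:
  assumes "coadj u v"
  obtains z where "z \<in> V" "z \<noteq> u" "z \<noteq> v" "\<not> coadj u z" "\<not> coadj v z"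
proof -
  obtain z where "E u z" "E v z" using common_nbr[of u v] assms unfolding coadj_def by blast
  then show thesis using that[of z] EV E_irr unfolding coadj_def by blast
qed
lemma coadj_tau: obtains u v where "coadj u v" "u \<noteq> p" "u \<noteq> q" "v \<noteq> p" "v \<noteq> q"
  using tau[of p q] unfolding coadj_def by auto

text \<open>Comparing only on chosen witnesses \<open>T\<close> weakens the alternatives, but turns
  every configuration below into a propositional problem about finitely many complement
  adjacencies.\<close>

lemma bad4:
  assumes "a \<in> V" "b \<in> V" "c \<in> V" "e \<in> V" "distinct [a, b, c, e]" and T: "T \<subseteq> V - {a,b,c,e}"
  shows "(\<not> coadj a b \<and> (\<forall>w\<in>T. coadj a w = coadj b w)) \<or> (\<not> coadj a c \<and> (\<forall>w\<in>T. coadj a w = coadj c w))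
    \<or> (\<not> coadj a e \<and> (\<forall>w\<in>T. coadj a w = coadj e w)) \<or> (\<not> coadj b c \<and> (\<forall>w\<in>T. coadj b w = coadj c w))
    \<or> (\<not> coadj b e \<and> (\<forall>w\<in>T. coadj b w = coadj e w)) \<or> (\<not> coadj c e \<and> (\<forall>w\<in>T. coadj c w = coadj e w))"
proof -
  have *: "coadj u w \<longleftrightarrow> \<not> E u w" if "u \<in> {a,b,c,e}" "w \<in> T" for u w
    using that T assms(1-4) unfolding coadj_def by blast
  have "\<not> coadj u v \<and> (\<forall>w\<in>T. coadj u w = coadj v w)"
    if "E u v \<and> (\<forall>w\<in>V - {a,b,c,e}. E u w = E v w)" "u \<in> {a,b,c,e}" "v \<in> {a,b,c,e}" for u v
  proof -
    have "\<not> coadj u v" using that(1) unfolding coadj_def by blast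
    then show ?thesis using *[OF that(2)] *[OF that(3)] that(1) T by blast
  qed
  then show ?thesis using bad4_adj[OF assms(1-5)] by (elim disjE) simp_all
qed

section \<open>Five-cycles and four-vertex paths in the complement\<close>

lemma C5_covers:
  assumes h: "coadj a b" "coadj b c" "coadj c e" "coadj e f" "coadj f a"
  shows "V = {a, b, c, e, f}" "distinct [a, b, c, e, f]"
proof -
  have n: "\<not> coadj a c" "\<not> coadj b e" "\<not> coadj c f" "\<not> coadj a e" "\<not> coadj b f"
    using h coadj_tri coadj_comm[of a f] coadj_comm[of e c] coadj_comm[of f e] by metis+
  show dist: "distinct [a, b, c, e, f]" using h n coadj_irr coadj_comm by auto
  have V: "a \<in> V" "b \<in> V" "c \<in> V" "e \<in> V" "f \<in> V" using h coadj_V by blast+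
  have False if w: "w \<in> V" "w \<notin> {a, b, c, e, f}" for w
  proof -
    have t: "\<not> (coadj a w \<and> coadj b w)" "\<not> (coadj b w \<and> coadj c w)" "\<not> (coadj c w \<and> coadj e w)" "\<not> (coadj e w \<and> coadj f w)"
      "\<not> (coadj f w \<and> coadj a w)" using h coadj_tri coadj_comm by metis+
    \<comment> \<open>By triangle-freeness \<open>w\<close> has at most two complement neighbours on
      the cycle, never consecutive ones. Each instance uses four of the six vertices and leaves the
      other two as witnesses.\<close>
    show False
      using bad4[of a b c e "{f, w}"] bad4[of a b e f "{c, w}"] bad4[of a c f w "{b, e}"]
        bad4[of b e a w "{c, f}"] bad4[of c f b w "{e, a}"] bad4[of a c e w "{b, f}"]
        V dist w h n t by (simp add: coadj_comm) argo
  qed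
  then show "V = {a, b, c, e, f}" using V by blast
qed

lemma P5_vertex:
  assumes h: "coadj a b" "coadj b c" "coadj c e" "coadj e f"
    and n: "\<not> coadj a c" "\<not> coadj a e" "\<not> coadj a f" "\<not> coadj b e" "\<not> coadj b f" "\<not> coadj c f"
    and dist: "distinct [a, b, c, e, f, w]" and w: "coadj w a \<or> coadj w c \<or> coadj w f"
  shows False
proof -
  have V: "a \<in> V" "b \<in> V" "c \<in> V" "e \<in> V" "f \<in> V" "w \<in> V" using h w coadj_V by blast+
  have t: "\<not> (coadj a w \<and> coadj b w)" "\<not> (coadj b w \<and> coadj c w)" "\<not> (coadj c w \<and> coadj e w)" "\<not> (coadj e w \<and> coadj f w)"
    using h coadj_tri coadj_comm by metis+
  \<comment> \<open>On \<open>b\<close>, \<open>e\<close> the vertices \<open>a\<close>,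
    \<open>c\<close>, \<open>f\<close> show the patterns 10, 11, 01, and \<open>w\<close> must
    repeat one of them. Triangle-freeness then leaves \<open>w\<close> joined to \<open>b\<close>
    and \<open>f\<close> or to \<open>e\<close> and \<open>a\<close>, and in both cases
    \<open>{a, b, e, f}\<close> is good.\<close>
  show False
    using bad4[of a b e f "{c, w}"] bad4[of a c f w "{b, e}"] V dist w h n t
    by (simp add: coadj_comm) argo
qed

lemma P5_edge:
  assumes h: "coadj a b" "coadj b c" "coadj c e" "coadj e f"
    and n: "\<not> coadj a c" "\<not> coadj a e" "\<not> coadj a f" "\<not> coadj b e" "\<not> coadj b f" "\<not> coadj c f"
    and dist: "distinct [a, b, c, e, f, t]" "distinct [a, b, c, e, f, u]" and tu: "coadj t u"
    and nt: "\<not> coadj t a" "\<not> coadj t c" "\<not> coadj t f" "\<not> coadj u a" "\<not> coadj u c" "\<not> coadj u f"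
  shows False
proof -
  have V: "a \<in> V" "b \<in> V" "c \<in> V" "e \<in> V" "f \<in> V" "t \<in> V" "u \<in> V" "t \<noteq> u"
    using h tu coadj_V coadj_irr by blast+
  have t: "\<not> (coadj t b \<and> coadj u b)" "\<not> (coadj t e \<and> coadj u e)" using tu coadj_tri coadj_comm by metis+
  \<comment> \<open>Here \<open>{a, b, e, t}\<close> is good: \<open>c\<close> separates
    \<open>b\<close>, \<open>e\<close> from \<open>a\<close>, \<open>t\<close>, while
    \<open>f\<close> separates \<open>b\<close> from \<open>e\<close> and \<open>u\<close> separates
    \<open>a\<close> from \<open>t\<close>.\<close>
  show False
    using bad4[of a b e t "{c, f, u}"] V dist tu h n nt t by (simp add: coadj_comm) argo
qed

text \<open>Since \<open>b\<close> and \<open>e\<close> cover the path, a complement edge avoiding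
  both either reaches \<open>a\<close>, \<open>c\<close> or \<open>f\<close> from outside or misses
  all three.\<close>

lemma no_P5:
  assumes h: "coadj a b" "coadj b c" "coadj c e" "coadj e f"
    and n: "\<not> coadj a c" "\<not> coadj a e" "\<not> coadj a f" "\<not> coadj b e" "\<not> coadj b f" "\<not> coadj c f"
  shows False
proof -
  have dist: "distinct [a, b, c, e, f]" using h n coadj_comm coadj_irr by auto
  obtain t u where tu: "coadj t u" "t \<noteq> b" "t \<noteq> e" "u \<noteq> b" "u \<noteq> e" using coadj_tau[of b e] .
  have notin: "t \<notin> {a, c, f}" "u \<notin> {a, c, f}"
  proof -
    have "False" if "coadj x y" "x \<in> {a, c, f}" "y \<noteq> b" "y \<noteq> e" for x y
    proof -
      have "y \<notin> {a, c, f}" using that n coadj_comm coadj_irr by auto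
      then show False using P5_vertex[OF h n, of y] that dist coadj_comm by auto
    qed
    then show "t \<notin> {a, c, f}" "u \<notin> {a, c, f}" using tu coadj_comm by blast+
  qed
  then have d2: "distinct [a, b, c, e, f, t]" "distinct [a, b, c, e, f, u]" using tu dist by auto
  then show False using P5_edge[OF h n d2 tu(1)] P5_vertex[OF h n] by blast
qed

definition P4_K1 :: "'a \<Rightarrow> 'a \<Rightarrow> 'a \<Rightarrow> 'a \<Rightarrow> 'a \<Rightarrow> bool" where
  "P4_K1 p q r s z \<longleftrightarrow> coadj p q \<and> coadj q r \<and> coadj r s \<and> \<not> coadj p r \<and> \<not> coadj p s \<and> \<not> coadj q s
     \<and> z \<in> V \<and> distinct [p, q, r, s, z] \<and> \<not> coadj z p \<and> \<not> coadj z q \<and> \<not> coadj z r \<and> \<not> coadj z s"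

lemma P4_K1_rev: "P4_K1 p q r s z \<Longrightarrow> P4_K1 s r q p z"
  unfolding P4_K1_def using coadj_comm by auto

text \<open>On \<open>q\<close>, \<open>s\<close> the vertices \<open>p\<close>, \<open>r\<close>,
  \<open>z\<close> show the patterns 10, 11, 00, and on \<open>p\<close>, \<open>r\<close> the
  vertices \<open>q\<close>, \<open>s\<close>, \<open>z\<close> show 11, 01, 00. As neither four-set
  with \<open>t\<close> is good, \<open>t\<close> repeats a pattern of each list, and
  triangle-freeness makes it a copy of \<open>r\<close> or of \<open>q\<close>.\<close>

lemma P4_K1_vertex:
  assumes P: "P4_K1 p q r s z" and t: "t \<notin> {p, q, r, s, z}" "coadj t p \<or> coadj t s \<or> coadj t z"
  shows "coadj t q \<and> coadj t s \<and> \<not> coadj t p \<and> \<not> coadj t r \<and> \<not> coadj t z \<or> coadj t p \<and> coadj t r \<and> \<not> coadj t q \<and> \<not> coadj t s \<and> \<not> coadj t z"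
proof -
  have V: "p \<in> V" "q \<in> V" "r \<in> V" "s \<in> V" "z \<in> V" "t \<in> V"
    using P t coadj_V unfolding P4_K1_def by blast+
  have tr: "\<not> (coadj t p \<and> coadj t q)" "\<not> (coadj t q \<and> coadj t r)" "\<not> (coadj t r \<and> coadj t s)"
    using P coadj_tri coadj_comm unfolding P4_K1_def by metis+
  show ?thesis
    using bad4[of p r z t "{q, s}"] bad4[of q s z t "{p, r}"] V t P tr
    unfolding P4_K1_def by (simp add: coadj_comm) argo
qed

lemma P4_K1_edge_outside:
  assumes P: "P4_K1 p q r s z" and tu: "coadj t u" "t \<notin> {p, q, r, s, z}" "u \<notin> {p, q, r, s, z}"
    and n: "\<not> coadj t p" "\<not> coadj t s" "\<not> coadj t z" "\<not> coadj u p" "\<not> coadj u s" "\<not> coadj u z"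
  shows False
proof -
  have V: "p \<in> V" "q \<in> V" "r \<in> V" "s \<in> V" "z \<in> V" "t \<in> V" "u \<in> V" "t \<noteq> u"
    using P tu coadj_V coadj_irr unfolding P4_K1_def by blast+
  have tr: "\<not> (coadj t q \<and> coadj u q)" "\<not> (coadj t r \<and> coadj u r)" "\<not> (coadj t q \<and> coadj t r)"
    using P tu coadj_tri coadj_comm unfolding P4_K1_def by metis+
  \<comment> \<open>In \<open>{p, r, z, t}\<close>, \<open>s\<close> separates \<open>r\<close> from
    the others, \<open>u\<close> separates \<open>t\<close> from \<open>p\<close> and
    \<open>z\<close>, and \<open>q\<close> separates \<open>p\<close> from \<open>z\<close>.\<close>
  show ?thesis
    using bad4[of p r z t "{q, s, u}"] V tu P tr n
    unfolding P4_K1_def by (simp add: coadj_comm) argo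
qed

lemma P4_K1_pendant:
  assumes P: "P4_K1 p q r s z" and t: "t \<notin> {p, q, r, s, z}" "coadj t q" "coadj t s" "\<not> coadj t p" "\<not> coadj t r" "\<not> coadj t z"
    and u: "coadj t u" "u \<notin> {p, q, r, s, z}"
  shows False
proof -
  have V: "p \<in> V" "q \<in> V" "r \<in> V" "s \<in> V" "z \<in> V" "t \<in> V" "u \<in> V" "t \<noteq> u"
    using P u coadj_V coadj_irr unfolding P4_K1_def by blast+
  have tr: "\<not> coadj u q" "\<not> coadj u s"
    using t u coadj_tri coadj_comm by metis+
  \<comment> \<open>Triangle-freeness keeps \<open>u\<close> off \<open>q\<close> and
    \<open>s\<close>, so \<open>{p, r, z, u}\<close> is good: \<open>t\<close> separates
    \<open>u\<close> from the others, and \<open>q\<close>, \<open>s\<close> separate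
    \<open>p\<close>, \<open>r\<close>, \<open>z\<close>.\<close>
  show ?thesis
    using bad4[of p r z u "{q, s, t}"] V u P tr t
    unfolding P4_K1_def by (simp add: coadj_comm) argo
qed

lemma P4_K1_edge:
  assumes P: "P4_K1 p q r s z" and tu: "coadj t u" "t \<notin> {q, r}" "u \<notin> {q, r}"
  shows "t = s \<and> coadj u q \<or> t = p \<and> coadj u r \<or> u = s \<and> coadj t q \<or> u = p \<and> coadj t r"
proof -
  have n: "\<not> coadj x y" if "x \<in> {p, s, z}" "y \<in> {p, s, z}" for x y
    using that P coadj_comm coadj_irr unfolding P4_K1_def by auto
  have one: "x = s \<and> coadj y q \<or> x = p \<and> coadj y r" if "coadj x y" "x \<in> {p, s, z}" "y \<notin> {q, r}" for x y
  proof -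
    have "y \<notin> {p, q, r, s, z}" using that n by blast
    then show ?thesis using P4_K1_vertex[OF P, of y] that coadj_comm by auto
  qed
  show ?thesis
  proof (cases "t \<in> {p, s, z} \<or> u \<in> {p, s, z}")
    case True then show ?thesis using one tu coadj_comm by blast
  next
    case False
    then have *: "t \<notin> {p, q, r, s, z}" "u \<notin> {p, q, r, s, z}" using tu by auto
    have "False" if "coadj x y" "x \<notin> {p, q, r, s, z}" "y \<notin> {p, q, r, s, z}" "coadj x p \<or> coadj x s \<or> coadj x z" for x y
      using P4_K1_vertex[OF P that(2,4)] P4_K1_pendant[OF P that(2) _ _ _ _ _ that(1,3)]
        P4_K1_pendant[OF P4_K1_rev[OF P], of x y] that by auto
    then show ?thesis using P4_K1_edge_outside[OF P tu(1) *] * tu(1) coadj_comm by metis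
  qed
qed

text \<open>Here \<open>t\<close> is a copy of \<open>r\<close>, and \<open>q\<close>,
  \<open>s\<close> cover both paths \<open>p q r s\<close> and \<open>p q t s\<close>. By
  \<open>P4_K1_edge\<close> for both paths, an edge avoiding \<open>q\<close>, \<open>s\<close>
  joins \<open>p\<close> to some \<open>y\<close> adjacent to \<open>r\<close> and \<open>t\<close>;
  then \<open>{p, q, r, z}\<close> is good with witnesses \<open>s\<close>, \<open>t\<close>,
  \<open>y\<close>.\<close>

lemma no_P4_K1_aux:
  assumes P: "P4_K1 p q r s z" and t: "coadj s t" "coadj q t" "t \<noteq> r"
  shows False
proof -
  have "t \<notin> {p, q, r, s, z}" using P t coadj_comm coadj_irr unfolding P4_K1_def by auto
  then have nt: "\<not> coadj t p" "\<not> coadj t r" "\<not> coadj t z" using P4_K1_vertex[OF P, of t] t coadj_comm by auto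
  then have P': "P4_K1 p q t s z"
    using P t \<open>t \<notin> {p, q, r, s, z}\<close> coadj_comm coadj_V unfolding P4_K1_def by auto
  have npr: "\<not> coadj r p" "p \<noteq> r" "r \<noteq> s" "p \<noteq> t" "s \<noteq> t" "\<not> coadj s q" "\<not> coadj p s"
    using P P' coadj_comm unfolding P4_K1_def by auto
  obtain f g where fg: "coadj f g" "f \<noteq> q" "f \<noteq> s" "g \<noteq> q" "g \<noteq> s" using coadj_tau[of q s] .
  have no: "x \<notin> {r, t}" if "coadj x y" "y \<noteq> q" "y \<noteq> s" for x y
  proof
    assume "x \<in> {r, t}"
    then show False
      using P4_K1_edge[OF P, of x y] P4_K1_edge[OF P', of x y] that nt npr
        \<open>t \<notin> {p, q, r, s, z}\<close> coadj_comm P P' unfolding P4_K1_def by auto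
  qed
  have nos: "f \<notin> {r, t}" "g \<notin> {r, t}" using no[of f g] no[of g f] fg coadj_comm by auto
  have "\<exists>y. coadj p y \<and> coadj y r \<and> coadj y t \<and> y \<noteq> q"
    using P4_K1_edge[OF P, of f g] P4_K1_edge[OF P', of f g] fg nos coadj_comm coadj_irr by auto
  then obtain y where y: "coadj p y" "coadj y r" "coadj y t" "y \<noteq> q" by blast
  then have y': "y \<notin> {p, q, r, s, z}" "y \<noteq> t" using P coadj_comm coadj_irr npr unfolding P4_K1_def by auto
  then have ny: "\<not> coadj y q" "\<not> coadj y s" "\<not> coadj y z" using P4_K1_vertex[OF P y'(1)] y coadj_comm by auto
  have V: "p \<in> V" "q \<in> V" "r \<in> V" "s \<in> V" "z \<in> V" "t \<in> V" "y \<in> V"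
    using P t y coadj_V unfolding P4_K1_def by blast+
  show False
    using bad4[of p q r z "{s, t, y}"] V P P' nt ny y y' t unfolding P4_K1_def
    by (simp add: coadj_comm) blast
qed

lemma no_P4_K1: "\<not> P4_K1 p q r s z"
proof
  assume P: "P4_K1 p q r s z"
  obtain t u where tu: "coadj t u" "t \<noteq> q" "t \<noteq> r" "u \<noteq> q" "u \<noteq> r" using coadj_tau[of q r] .
  then show False
    using P4_K1_edge[OF P, of t u] no_P4_K1_aux[OF P, of t] no_P4_K1_aux[OF P, of u]
      no_P4_K1_aux[OF P4_K1_rev[OF P], of t] no_P4_K1_aux[OF P4_K1_rev[OF P], of u] coadj_comm
    by auto
qed

text \<open>As the middle edge is not dominating, some \<open>z\<close> is joined to neither
  \<open>q\<close> nor \<open>r\<close>. Depending on its adjacency to \<open>p\<close> and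
  \<open>s\<close>, it closes a five-cycle, prolongs the path to an induced one on five vertices, or
  is isolated from the path.\<close>

lemma P4_in_C5:
  assumes h: "coadj p q" "coadj q r" "coadj r s" and n: "\<not> coadj p s" "p \<noteq> s"
  obtains z where "V = {p, q, r, s, z}" "distinct [p, q, r, s, z]" "coadj s z" "coadj z p"
proof -
  have n': "\<not> coadj p r" "\<not> coadj q s" using h coadj_tri by blast+
  obtain z where z: "z \<in> V" "z \<noteq> q" "z \<noteq> r" "\<not> coadj q z" "\<not> coadj r z" using coadj_nondom[OF h(2)] .
  have dist: "distinct [p, q, r, s, z]" using h n n' z coadj_comm coadj_irr by auto
  consider "coadj z p" "coadj z s" | "coadj z p" "\<not> coadj z s" | "\<not> coadj z p" "coadj z s" | "\<not> coadj z p" "\<not> coadj z s" by blast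
  then show thesis
  proof cases
    case 1
    then have "coadj s z" using coadj_comm by blast
    then show thesis using that C5_covers(1)[OF h _ 1(1)] dist 1 by blast
  next
    case 2
    then show thesis using no_P5[OF 2(1) h] z n n' coadj_comm by blast
  next
    case 3
    have "coadj s z" using 3 coadj_comm by blast
    then show thesis using no_P5[OF h] 3 z n n' coadj_comm by blast
  next
    case 4
    then have "P4_K1 p q r s z" using h n n' dist z coadj_comm unfolding P4_K1_def by auto
    then show thesis using no_P4_K1 by blast
  qed
qed

section \<open>Disjoint complement edges and the complete bipartite case\<close>

lemma two_edges_extend:
  assumes h: "coadj a b" "coadj c e" and n: "\<not> coadj a c" "\<not> coadj a e" "\<not> coadj b c" "\<not> coadj b e"
  shows "(\<exists>t. coadj b t \<and> t \<noteq> a) \<or> (\<exists>t. coadj e t \<and> t \<noteq> c)"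
proof (rule ccontr)
  assume *: "\<not> ?thesis"
  obtain t u where tu: "coadj t u" "t \<noteq> a" "t \<noteq> c" "u \<noteq> a" "u \<noteq> c" using coadj_tau[of a c] .
  have nt: "\<not> coadj b t" "\<not> coadj b u" "\<not> coadj e t" "\<not> coadj e u" using * tu by auto
  then have "t \<noteq> b" "u \<noteq> b" "t \<noteq> e" "u \<noteq> e" using tu coadj_comm by blast+
  moreover have "a \<in> V" "b \<in> V" "c \<in> V" "e \<in> V" "t \<in> V" "u \<in> V" using h tu coadj_V by blast+
  moreover have "a \<noteq> b" "c \<noteq> e" "a \<noteq> c" "a \<noteq> e" "b \<noteq> c" "b \<noteq> e" "t \<noteq> u" using h n tu coadj_comm coadj_irr by auto
  \<comment> \<open>On \<open>b\<close>, \<open>e\<close> the vertices \<open>a\<close> and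
    \<open>c\<close> show 10 and 01, while \<open>t\<close>, \<open>u\<close> both show 00 but are
    joined in the complement; so \<open>{a, c, t, u}\<close> is good.\<close>
  ultimately show False using bad4[of a c t u "{b, e}"] h n tu nt by (simp add: coadj_comm)
qed

text \<open>\<open>P4\<close> keeps the extra neighbours \<open>t\<close>, \<open>u\<close> off
  \<open>c\<close> and \<open>e\<close>, so they separate \<open>a\<close> and \<open>b\<close> from
  \<open>c\<close> and \<open>e\<close>. The pairs \<open>a b\<close> and \<open>c e\<close> are
  complement edges and need no witness.\<close>

lemma two_edges_not_both:
  assumes P4: "\<forall>p q r s. coadj p q \<longrightarrow> coadj q r \<longrightarrow> coadj r s \<longrightarrow> p \<noteq> s \<longrightarrow> coadj p s"
    and h: "coadj a b" "coadj c e" and n: "\<not> coadj a c" "\<not> coadj a e" "\<not> coadj b c" "\<not> coadj b e"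
    and t: "coadj b t" "t \<noteq> a" and u: "coadj a u" "u \<noteq> b"
  shows False
proof -
  have dist: "a \<noteq> b" "c \<noteq> e" "a \<noteq> c" "a \<noteq> e" "b \<noteq> c" "b \<noteq> e" using h n coadj_comm coadj_irr by auto
  have nt: "\<not> coadj t c" "\<not> coadj t e" "\<not> coadj u c" "\<not> coadj u e"
    using P4[rule_format, of a b t] P4[rule_format, of b a u] h t u n dist coadj_comm by blast+
  have nab: "\<not> coadj a t" "\<not> coadj b u" using coadj_tri h t u coadj_comm by blast+
  have "t \<notin> {a, b, c, e}" "u \<notin> {a, b, c, e}" using t u n coadj_irr coadj_comm by auto
  moreover have "a \<in> V" "b \<in> V" "c \<in> V" "e \<in> V" "t \<in> V" "u \<in> V" using h t u coadj_V by blast+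
  ultimately show False using bad4[of a b c e "{t, u}"] h n t u nt nab dist by (simp add: coadj_comm)
qed

text \<open>Applying \<open>two_edges_extend\<close> to all four choices of one end per edge yields
  an edge that is extended at both ends.\<close>

lemma no_2K2:
  assumes P4: "\<forall>p q r s. coadj p q \<longrightarrow> coadj q r \<longrightarrow> coadj r s \<longrightarrow> p \<noteq> s \<longrightarrow> coadj p s"
    and h: "coadj a b" "coadj c e" and n: "\<not> coadj a c" "\<not> coadj a e" "\<not> coadj b c" "\<not> coadj b e"
  shows False
proof -
  let ?x = "\<lambda>b a. \<exists>t. coadj b t \<and> t \<noteq> a"
  have h': "coadj b a" "coadj e c" and n': "\<not> coadj c a" "\<not> coadj e a" "\<not> coadj c b" "\<not> coadj e b" using h n coadj_comm by auto
  have "?x b a \<or> ?x e c" "?x b a \<or> ?x c e" "?x a b \<or> ?x e c" "?x a b \<or> ?x c e"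
    using two_edges_extend[of a b c e] two_edges_extend[of a b e c] two_edges_extend[of b a c e]
      two_edges_extend[of b a e c] h h' n by blast+
  moreover have "\<not> (?x b a \<and> ?x a b)" "\<not> (?x e c \<and> ?x c e)"
    using two_edges_not_both[OF P4 h n] two_edges_not_both[OF P4 h(2,1) n'(1,3,2,4)] by blast+
  ultimately show False by blast
qed

text \<open>The parts are the complement neighbourhoods of the ends of any one edge:
  \<open>P4\<close> joins them completely, triangle-freeness makes them independent, and
  \<open>no_2K2\<close> leaves no further edges.\<close>

lemma complete_bipartite_complement:
  assumes P4: "\<forall>p q r s. coadj p q \<longrightarrow> coadj q r \<longrightarrow> coadj r s \<longrightarrow> p \<noteq> s \<longrightarrow> coadj p s"
  obtains X Y where "X \<subseteq> V" "Y \<subseteq> V" "X \<inter> Y = {}" "X \<union> Y \<noteq> V" "2 \<le> card X" "2 \<le> card Y"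
    "\<And>u v. coadj u v \<longleftrightarrow> u \<in> X \<and> v \<in> Y \<or> u \<in> Y \<and> v \<in> X"
proof -
  obtain a b where ab: "coadj a b" using coadj_tau .
  define X where "X = {v. coadj b v}"
  define Y where "Y = {v. coadj a v}"
  have sub: "X \<subseteq> V" "Y \<subseteq> V" unfolding X_def Y_def using coadj_V by auto
  have disj: "X \<inter> Y = {}" unfolding X_def Y_def using ab coadj_tri by blast
  have into: "u \<in> X \<union> Y" if "coadj u v" for u v
  proof (rule ccontr)
    assume "u \<notin> X \<union> Y"
    then have nu: "\<not> coadj b u" "\<not> coadj a u" unfolding X_def Y_def by auto
    have "\<not> coadj a v" using P4[rule_format, of b a v u] ab nu that coadj_comm by blast
    moreover have "\<not> coadj b v" using P4[rule_format, of a b v u] ab nu that coadj_comm by blast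
    ultimately show False using no_2K2[OF P4 ab that] nu by blast
  qed
  have ind: "\<not> coadj u v" if "u \<in> X \<and> v \<in> X \<or> u \<in> Y \<and> v \<in> Y" for u v
    using that coadj_tri coadj_comm unfolding X_def Y_def by blast
  have XY: "coadj u v" if "u \<in> X" "v \<in> Y" for u v
    using that P4[rule_format, of u b a v] ab coadj_comm disj unfolding X_def Y_def by blast
  have iff: "coadj u v \<longleftrightarrow> u \<in> X \<and> v \<in> Y \<or> u \<in> Y \<and> v \<in> X" for u v
    using into[of u v] into[of v u] ind XY coadj_comm by blast
  have fin': "finite X" "finite Y" using sub fin finite_subset by auto
  have mem: "a \<in> X" "b \<in> Y" unfolding X_def Y_def using ab coadj_comm by auto
  \<comment> \<open>An edge avoiding only \<open>a\<close> puts a second vertex into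
    \<open>X\<close>; likewise with \<open>b\<close> and \<open>Y\<close>.\<close>
  obtain u v where uv: "coadj u v" "u \<noteq> a" "v \<noteq> a" using coadj_tau[of a a] .
  obtain u' v' where uv': "coadj u' v'" "u' \<noteq> b" "v' \<noteq> b" using coadj_tau[of b b] .
  obtain x where "x \<in> X" "x \<noteq> a" using uv iff by blast
  then have "card {a, x} \<le> card X" using mem fin' by (intro card_mono) auto
  then have "2 \<le> card X" using \<open>x \<noteq> a\<close> by simp
  moreover obtain y where "y \<in> Y" "y \<noteq> b" using uv' iff by blast
  then have "card {b, y} \<le> card Y" using mem fin' by (intro card_mono) auto
  then have "2 \<le> card Y" using \<open>y \<noteq> b\<close> by simp
  moreover obtain z where "z \<in> V" "\<not> coadj a z" "\<not> coadj b z" using coadj_nondom[OF ab] by blast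
  then have "X \<union> Y \<noteq> V" unfolding X_def Y_def by blast
  ultimately show thesis using that sub disj iff by blast
qed

end

section \<open>Isomorphism with the listed graphs\<close>

text \<open>Trades the numbering for two vertex sets. Backwards, bijections of \<open>A\<close>,
  \<open>B\<close> and the rest onto consecutive intervals are glued together.\<close>

lemma Kminus_iso_iff:
  assumes "finite V" "lam + mu \<le> card V"
  shows "graph_iso V E {0..<card V} (Kminus_E (card V) lam mu) \<longleftrightarrow>
    (\<exists>A B. A \<subseteq> V \<and> B \<subseteq> V \<and> A \<inter> B = {} \<and> card A = lam \<and> card B = mu \<and>
      (\<forall>u\<in>V. \<forall>v\<in>V. E u v \<longleftrightarrow> u \<noteq> v \<and> \<not> (u \<in> A \<and> v \<in> B) \<and> \<not> (u \<in> B \<and> v \<in> A)))"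
    (is "?L \<longleftrightarrow> ?R")
proof
  assume ?L
  then obtain f where f: "bij_betw f V {0..<card V}"
    and E: "\<And>u v. u \<in> V \<Longrightarrow> v \<in> V \<Longrightarrow> E u v \<longleftrightarrow> Kminus_E (card V) lam mu (f u) (f v)"
    unfolding graph_iso_def by blast
  have inj: "inj_on f V" and img: "f ` V = {0..<card V}" using f by (auto simp: bij_betw_def)
  have card: "card {u \<in> V. f u \<in> I} = card I" if "I \<subseteq> {0..<card V}" for I
  proof -
    have "f ` {u \<in> V. f u \<in> I} = f ` V \<inter> I" by blast
    also have "\<dots> = I" unfolding img using that by blast
    finally have "f ` {u \<in> V. f u \<in> I} = I" .
    moreover have "inj_on f {u \<in> V. f u \<in> I}" using inj by (rule inj_on_subset) auto
    ultimately show ?thesis using card_image by metis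
  qed
  have lt: "f u < card V" if "u \<in> V" for u
    using imageI[OF that, of f] unfolding img by simp
  have eq: "f u = f v \<longleftrightarrow> u = v" if "u \<in> V" "v \<in> V" for u v using inj that by (simp add: inj_on_eq_iff)
  define A where "A = {u \<in> V. f u \<in> {0..<lam}}"
  define B where "B = {u \<in> V. f u \<in> {lam..<lam+mu}}"
  have cards: "card A = lam" "card B = mu"
    using card[of "{0..<lam}"] card[of "{lam..<lam+mu}"] assms unfolding A_def B_def by auto
  have sub: "A \<subseteq> V" "B \<subseteq> V" "A \<inter> B = {}" unfolding A_def B_def by auto
  have mem: "u \<in> A \<longleftrightarrow> f u < lam" "u \<in> B \<longleftrightarrow> lam \<le> f u \<and> f u < lam + mu" if "u \<in> V" for u
    using that unfolding A_def B_def by simp_all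
  have "E u v \<longleftrightarrow> u \<noteq> v \<and> \<not> (u \<in> A \<and> v \<in> B) \<and> \<not> (u \<in> B \<and> v \<in> A)"
    if "u \<in> V" "v \<in> V" for u v
    unfolding E[OF that] Kminus_E_def mem[OF that(1)] mem[OF that(2)]
    using lt[OF that(1)] lt[OF that(2)] eq[OF that] by blast
  then show ?R using cards sub by (intro exI[of _ A] exI[of _ B]) simp
next
  assume ?R
  then obtain A B where AB: "A \<subseteq> V" "B \<subseteq> V" "A \<inter> B = {}" "card A = lam" "card B = mu"
    and E: "\<And>u v. u \<in> V \<Longrightarrow> v \<in> V \<Longrightarrow> E u v \<longleftrightarrow> u \<noteq> v \<and> \<not> (u \<in> A \<and> v \<in> B) \<and> \<not> (u \<in> B \<and> v \<in> A)"
    by blast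
  define C where "C = V - (A \<union> B)"
  have fin: "finite A" "finite B" "finite C" using AB assms C_def finite_subset by auto
  have "card C = card V - (lam + mu)"
    unfolding C_def using AB fin by (simp add: card_Diff_subset card_Un_disjoint)
  then have "\<exists>f. bij_betw f A {0..<lam}" "\<exists>g. bij_betw g B {lam..<lam+mu}"
    "\<exists>k. bij_betw k C {lam+mu..<card V}"
    using AB fin by (intro finite_same_card_bij; simp)+
  then obtain f g k where fgk: "bij_betw f A {0..<lam}" "bij_betw g B {lam..<lam+mu}"
    "bij_betw k C {lam+mu..<card V}" by blast
  define F where "F u = (if u \<in> A then f u else if u \<in> B then g u else k u)" for u
  have Fv: "u \<in> A \<Longrightarrow> F u = f u" "u \<in> B \<Longrightarrow> F u = g u" "u \<in> C \<Longrightarrow> F u = k u" for u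
    using AB(3) unfolding F_def C_def by auto
  have FAB: "bij_betw F A {0..<lam}" "bij_betw F B {lam..<lam+mu}"
    and FC: "bij_betw F C {lam+mu..<card V}"
    using fgk bij_betw_cong[of A F f] bij_betw_cong[of B F g] bij_betw_cong[of C F k] Fv by blast+
  have bij: "bij_betw F (A \<union> B \<union> C) ({0..<lam} \<union> {lam..<lam+mu} \<union> {lam+mu..<card V})"
    by (rule bij_betw_combine[OF bij_betw_combine[OF FAB] FC]) auto
  have sets: "A \<union> B \<union> C = V" "{0..<lam} \<union> {lam..<lam+mu} \<union> {lam+mu..<card V} = {0..<card V}"
    using AB assms C_def by auto
  have FA: "u \<in> A \<Longrightarrow> F u < lam" and FB: "u \<in> B \<Longrightarrow> lam \<le> F u \<and> F u < lam + mu"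
    and FC': "u \<in> C \<Longrightarrow> lam + mu \<le> F u" for u
    using FAB FC by (auto simp: bij_betw_def)
  have Aiff: "u \<in> A \<longleftrightarrow> F u < lam" and Biff: "u \<in> B \<longleftrightarrow> lam \<le> F u \<and> F u < lam + mu" if "u \<in> V" for u
    using that FA[of u] FB[of u] FC'[of u] unfolding sets(1)[symmetric] by auto
  have lt: "F u < card V" if "u \<in> V" for u using imageI[OF that, of F] bij unfolding sets bij_betw_def by simp
  have eq: "F u = F v \<longleftrightarrow> u = v" if "u \<in> V" "v \<in> V" for u v
    using that bij unfolding sets bij_betw_def by (meson inj_on_eq_iff)
  show ?L unfolding graph_iso_def
  proof (intro exI conjI ballI)
    show "bij_betw F V {0..<card V}" using bij unfolding sets .
    show "E u v = Kminus_E (card V) lam mu (F u) (F v)" if "u \<in> V" "v \<in> V" for u v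
      unfolding E[OF that] Kminus_E_def Aiff[OF that(1)] Aiff[OF that(2)] Biff[OF that(1)] Biff[OF that(2)]
      using lt[OF that(1)] lt[OF that(2)] eq[OF that] by blast
  qed
qed

lemma ex_bij_preimage: "bij_betw f S T \<Longrightarrow> t \<in> T \<Longrightarrow> \<exists>s\<in>S. f s = t"
  unfolding bij_betw_def by auto

context conn_graph begin

lemma C5_iso_iff:
  "graph_iso V E {0..<5} C5_E \<longleftrightarrow> (\<exists>a b c e f. distinct [a, b, c, e, f] \<and> V = {a, b, c, e, f}
     \<and> E a b \<and> E b c \<and> E c e \<and> E e f \<and> E f a
     \<and> \<not> E a c \<and> \<not> E b e \<and> \<not> E c f \<and> \<not> E e a \<and> \<not> E f b)" (is "?L \<longleftrightarrow> ?R")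
proof
  assume ?L
  then obtain F where F: "bij_betw F V {0..<5::nat}"
    and E: "\<And>u v. u \<in> V \<Longrightarrow> v \<in> V \<Longrightarrow> E u v \<longleftrightarrow> C5_E (F u) (F v)"
    unfolding graph_iso_def by blast
  obtain a b c e f where v: "a \<in> V" "b \<in> V" "c \<in> V" "e \<in> V" "f \<in> V"
    "F a = 0" "F b = 1" "F c = 2" "F e = 3" "F f = 4"
    using ex_bij_preimage[OF F, of 0] ex_bij_preimage[OF F, of 1] ex_bij_preimage[OF F, of 2]
      ex_bij_preimage[OF F, of 3] ex_bij_preimage[OF F, of 4] by auto
  have dist: "distinct [a, b, c, e, f]" using v by auto
  then have "card {a, b, c, e, f} = card V" using bij_betw_same_card[OF F] by simp
  then have "V = {a, b, c, e, f}" using v fin by (intro card_subset_eq[symmetric]) auto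
  then show ?R using dist v by (intro exI[of _ a] exI[of _ b] exI[of _ c] exI[of _ e] exI[of _ f])
      (simp add: E C5_E_def)
next
  assume ?R
  then obtain a b c e f where v: "distinct [a, b, c, e, f]" "V = {a, b, c, e, f}"
    and E: "E a b" "E b c" "E c e" "E e f" "E f a" "\<not> E a c" "\<not> E b e" "\<not> E c f" "\<not> E e a" "\<not> E f b"
    by blast
  define F where "F = (\<lambda>_. 0::nat)(b := 1, c := 2, e := 3, f := 4)"
  have Fv: "F a = 0" "F b = 1" "F c = 2" "F e = 3" "F f = 4" using v(1) by (auto simp: F_def)
  have "{0..<5::nat} = {0,1,2,3,4}" by auto
  then have "bij_betw F V {0..<5}" unfolding bij_betw_def inj_on_def v(2) using Fv by auto
  moreover have "\<forall>u\<in>V. \<forall>v\<in>V. E u v \<longleftrightarrow> C5_E (F u) (F v)"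
    unfolding v(2) using E E_irr by (simp add: E_comm Fv C5_E_def)
  ultimately show ?L unfolding graph_iso_def by blast
qed

text \<open>The arguments play the roles of v1 to v6 in this order. The pair \<open>x\<close>,
  \<open>y\<close> is left open, which covers both forbidden graphs at once: the clique
  \<open>a\<close>, \<open>b\<close>, \<open>c\<close>, \<open>e\<close> shows all four adjacency
  patterns to \<open>x\<close>, \<open>y\<close>.\<close>

definition gamma :: "'a \<Rightarrow> 'a \<Rightarrow> 'a \<Rightarrow> 'a \<Rightarrow> 'a \<Rightarrow> 'a \<Rightarrow> bool" where
  "gamma a b c e x y \<longleftrightarrow> distinct [a, b, c, e, x, y] \<and> {a, b, c, e, x, y} \<subseteq> V
    \<and> E a b \<and> E a c \<and> E a e \<and> E b c \<and> E b e \<and> E c e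
    \<and> E a x \<and> E b x \<and> \<not> E c x \<and> \<not> E e x \<and> E a y \<and> \<not> E b y \<and> E c y \<and> \<not> E e y"

lemma gamma_of_induced:
  assumes "has_induced V E {1..6} Gamma1_E \<or> has_induced V E {1..6} Gamma2_E"
  obtains a b c e x y where "gamma a b c e x y"
proof -
  from assms obtain S F G where S: "S \<subseteq> V" and F: "bij_betw F S {1..6::nat}" and G: "G = Gamma1_E \<or> G = Gamma2_E"
    and E: "\<And>u v. u \<in> S \<Longrightarrow> v \<in> S \<Longrightarrow> E u v \<longleftrightarrow> G (F u) (F v)"
    unfolding has_induced_def graph_iso_def by blast
  obtain a b c e x y where v: "a \<in> S" "b \<in> S" "c \<in> S" "e \<in> S" "x \<in> S" "y \<in> S"
    "F a = 1" "F b = 2" "F c = 3" "F e = 4" "F x = 5" "F y = 6"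
    using ex_bij_preimage[OF F, of 1] ex_bij_preimage[OF F, of 2] ex_bij_preimage[OF F, of 3]
      ex_bij_preimage[OF F, of 4] ex_bij_preimage[OF F, of 5] ex_bij_preimage[OF F, of 6] by auto
  have "gamma a b c e x y"
    unfolding gamma_def using v S G by (auto simp: E Gamma1_E_def Gamma2_E_def doubleton_eq_iff)
  then show thesis using that by blast
qed

lemma induced_of_gamma:
  assumes "gamma a b c e x y"
  shows "has_induced V E {1..6} Gamma1_E \<or> has_induced V E {1..6} Gamma2_E"
proof -
  have dist: "distinct [a, b, c, e, x, y]" using assms unfolding gamma_def by blast
  define S where "S = {a, b, c, e, x, y}"
  define F where "F = (\<lambda>_. 1::nat)(b := 2, c := 3, e := 4, x := 5, y := 6)"
  have Fv: "F a = 1" "F b = 2" "F c = 3" "F e = 4" "F x = 5" "F y = 6" using dist by (auto simp: F_def)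
  have "{1..6::nat} = {1,2,3,4,5,6}" by auto
  then have bij: "bij_betw F S {1..6}" unfolding bij_betw_def inj_on_def S_def using Fv by auto
  have S: "S \<subseteq> V" using assms unfolding gamma_def S_def by blast
  have "\<forall>u\<in>S. \<forall>v\<in>S. (u \<in> S \<and> v \<in> S \<and> E u v) \<longleftrightarrow> (if E x y then Gamma2_E else Gamma1_E) (F u) (F v)"
    unfolding S_def using assms E_irr unfolding gamma_def
    by (simp add: E_comm Fv Gamma1_E_def Gamma2_E_def doubleton_eq_iff)
  then have "has_induced V E {1..6} (if E x y then Gamma2_E else Gamma1_E)"
    using bij S unfolding has_induced_def graph_iso_def by blast
  then show ?thesis by (metis (full_types))
qed

lemma gamma_good:
  assumes "gamma a b c e x y" shows "good {a, b, c, e}"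
proof -
  have w: "x \<in> V - {a, b, c, e}" "y \<in> V - {a, b, c, e}" and V: "a \<in> V" "b \<in> V" "c \<in> V" "e \<in> V"
    using assms unfolding gamma_def by auto
  then have xy: "x \<in> V" "y \<in> V" by auto
  have "d a y \<noteq> d b y" "d a x \<noteq> d c x" "d a x \<noteq> d e x" "d b x \<noteq> d c x" "d b x \<noteq> d e x" "d c y \<noteq> d e y"
    using assms adj_dist V xy unfolding gamma_def by blast+
  then show ?thesis unfolding good4_iff_cases using w by blast
qed

section \<open>Good sets in the listed graphs\<close>

text \<open>The labels \<open>f\<close> stand for twin classes or for the distance to the single
  critical vertex; \<open>T\<close> drops the members of \<open>S\<close> that lie outside the
  clique under consideration.\<close>

lemma not_good_pigeonhole:
  assumes "T \<subseteq> S" "card (f ` T) < card T"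
    and "\<And>u v. u \<in> T \<Longrightarrow> v \<in> T \<Longrightarrow> u \<noteq> v \<Longrightarrow> f u = f v \<Longrightarrow> E u v \<and> (\<forall>w\<in>V - S. d u w = d v w)"
  shows "\<not> good S"
proof -
  have "\<not> inj_on f T" using assms(2) card_image by (metis less_irrefl)
  then obtain u v where "u \<in> T" "v \<in> T" "u \<noteq> v" "f u = f v" unfolding inj_on_def by blast
  then have "u \<in> S" "v \<in> S" "E u v" "\<forall>w\<in>V - S. d u w = d v w" using assms(1,3) by blast+
  then show ?thesis unfolding good_def by blast
qed

text \<open>One vertex from each of \<open>A\<close>, \<open>B\<close> and the rest is a good
  triple, with second vertices of \<open>A\<close> and \<open>B\<close> as witnesses. Each of the
  three classes consists of true twins, so four vertices cannot be good.\<close>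

lemma Kminus_dim:
  assumes AB: "A \<subseteq> V" "B \<subseteq> V" "A \<inter> B = {}" "A \<union> B \<noteq> V" "2 \<le> card A" "2 \<le> card B"
    and E: "\<forall>u\<in>V. \<forall>v\<in>V. E u v \<longleftrightarrow> u \<noteq> v \<and> \<not> (u \<in> A \<and> v \<in> B) \<and> \<not> (u \<in> B \<and> v \<in> A)"
  shows "\<exists>S\<subseteq>V. card S = 3 \<and> good S" "\<not> (\<exists>S\<subseteq>V. card S = 4 \<and> good S)"
proof -
  have two: "\<exists>p q. p \<in> X \<and> q \<in> X \<and> p \<noteq> q" if "2 \<le> card X" for X :: "'a set"
  proof -
    have "finite X" using that card.infinite by fastforce
    then show ?thesis using card_le_Suc0_iff_eq[of X] that by auto
  qed
  obtain a a' b b' r where v: "a \<in> A" "a' \<in> A" "a \<noteq> a'" "b \<in> B" "b' \<in> B" "b \<noteq> b'" "r \<in> V - (A \<union> B)"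
    using two[OF AB(5)] two[OF AB(6)] AB by blast
  have V: "a \<in> V" "a' \<in> V" "b \<in> V" "b' \<in> V" "r \<in> V" using v AB by auto
  have n: "a \<noteq> b" "a \<noteq> r" "b \<noteq> r" "a' \<noteq> b" "a' \<noteq> r" "b' \<noteq> a" "b' \<noteq> r" using v AB by auto
  have "\<not> E a b" using E V v by blast
  moreover have "d a b' \<noteq> d r b'" "d b a' \<noteq> d r a'"
    using E V v n AB(3) by (intro adj_dist; blast)+
  moreover have "a' \<in> V - {a, b, r}" "b' \<in> V - {a, b, r}" using v n V by auto
  ultimately have "good {a, b, r}" by (intro goodI3) blast+
  then show "\<exists>S\<subseteq>V. card S = 3 \<and> good S"
    using V n by (intro exI[of _ "{a, b, r}"]) auto
  have "\<not> good S" if S: "S \<subseteq> V" "card S = 4" for S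
  proof (rule not_good_pigeonhole[of S S "\<lambda>u. (u \<in> A, u \<in> B)"])
    have "(\<lambda>u. (u \<in> A, u \<in> B)) ` S \<subseteq> {(True, False), (False, True), (False, False)}" using AB by auto
    then have "card ((\<lambda>u. (u \<in> A, u \<in> B)) ` S) \<le> card {(True, False), (False, True), (False, False)}"
      by (intro card_mono) auto
    then show "card ((\<lambda>u. (u \<in> A, u \<in> B)) ` S) < card S" using S by simp
    fix u v assume uv: "u \<in> S" "v \<in> S" "u \<noteq> v" "(u \<in> A, u \<in> B) = (v \<in> A, v \<in> B)"
    then have "E u v" using E S AB by auto
    moreover have "E u w = E v w" if "w \<in> V - {u, v}" for w
      using E[rule_format, of u w] E[rule_format, of v w] that S(1) uv by auto
    ultimately show "E u v \<and> (\<forall>w\<in>V - S. d u w = d v w)" using twins_same_dist[of u v] uv by blast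
  qed simp
  then show "\<not> (\<exists>S\<subseteq>V. card S = 4 \<and> good S)" by blast
qed

text \<open>A four-set omits one vertex, whose two non-neighbours are adjacent and both at distance
  2 from it. Rotation reduces everything to the omission of \<open>a\<close>.\<close>

lemma C5_dim:
  assumes dist: "distinct [a, b, c, e, f]" and V: "V = {a, b, c, e, f}"
    and E: "E a b" "E b c" "E c e" "E e f" "E f a"
    "\<not> E a c" "\<not> E b e" "\<not> E c f" "\<not> E e a" "\<not> E f b"
  shows "\<exists>S\<subseteq>V. card S = 3 \<and> good S" "\<not> (\<exists>S\<subseteq>V. card S = 4 \<and> good S)"
proof -
  have "d c b \<noteq> d e b" "d e a \<noteq> d f a" using E V E_comm by (intro adj_dist; auto)+
  then have "good {c, e, f}" using E V dist by (intro goodI3) auto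
  then show "\<exists>S\<subseteq>V. card S = 3 \<and> good S"
    using V dist by (intro exI[of _ "{c, e, f}"]) auto
  have path: "\<not> good (V - {a})" if dist: "distinct [a, b, c, e, f]" and V: "V = {a, b, c, e, f}"
    and E: "E a b" "E b c" "E c e" "E e f" "E f a" "\<not> E a c" "\<not> E e a" for a b c e f
  proof -
    have "d c a = 2" "d e a = 2" using d_2[of c a] d_2[of e a] that E_comm by auto
    moreover have "c \<in> V - {a}" "e \<in> V - {a}" using that by auto
    ultimately show ?thesis using that unfolding good_def by (metis Diff_Diff_Int Diff_iff Int_iff insertE singletonD)
  qed
  have "\<not> good (V - {w})" if "w \<in> V" for w
  proof -
    have "V = {b, c, e, f, a}" "V = {c, e, f, a, b}" "V = {e, f, a, b, c}" "V = {f, a, b, c, e}"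
      using V by auto
    then have "\<not> good (V - {a})" "\<not> good (V - {b})" "\<not> good (V - {c})" "\<not> good (V - {e})" "\<not> good (V - {f})"
      using path[of a b c e f] path[of b c e f a] path[of c e f a b] path[of e f a b c] path[of f a b c e]
        dist V E E_sym by auto
    then show ?thesis using that V by blast
  qed
  moreover have "\<exists>w\<in>V. S = V - {w}" if S: "S \<subseteq> V" "card S = 4" for S
  proof -
    have "card V = 5" using V dist by simp
    then have "card (V - S) = 1" using S fin by (simp add: card_Diff_subset finite_subset)
    then obtain w where "V - S = {w}" using card_1_singletonE by blast
    then show ?thesis using S by blast
  qed
  ultimately show "\<not> (\<exists>S\<subseteq>V. card S = 4 \<and> good S)" by metis
qed

text \<open>If \<open>x\<close> is in \<open>S\<close>, every outside vertex is at distance 1 from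
  the other two members. If not, adjacency to \<open>x\<close> sorts three clique vertices into two
  twin classes.\<close>

lemma not_good3_of_big_clique:
  assumes K: "K \<subseteq> V" "is_clique E K" "V \<subseteq> insert x K" and S: "S \<subseteq> V" "card S = 3"
  shows "\<not> good S"
proof (cases "x \<in> S")
  case True
  then have "card (S - {x}) = 2" using S by simp
  moreover from this have "card ((\<lambda>_. ()) ` (S - {x})) \<le> 1" using card_image_le[of "UNIV :: unit set"] by (simp add: card_le_Suc0_iff_eq)
  ultimately have "card ((\<lambda>_. ()) ` (S - {x})) < card (S - {x})" by simp
  then show ?thesis
  proof (rule not_good_pigeonhole[rotated])
    fix u v assume uv: "u \<in> S - {x}" "v \<in> S - {x}" "u \<noteq> v"
    then have in_K: "u \<in> K" "v \<in> K" using S K by auto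
    have "d u w = 1 \<and> d v w = 1" if "w \<in> V - S" for w
    proof -
      have "w \<in> K" using that True K by auto
      then have "E u w" "E v w" using in_K that uv K unfolding is_clique_def by auto
      then show ?thesis using d_1 in_K K that by blast
    qed
    then show "E u v \<and> (\<forall>w\<in>V - S. d u w = d v w)" using in_K uv K unfolding is_clique_def by auto
  qed auto
next
  case False
  have "card ((\<lambda>u. E u x) ` S) \<le> card (UNIV :: bool set)" by (intro card_mono) auto
  then have "card ((\<lambda>u. E u x) ` S) < card S" using S by simp
  then show ?thesis
  proof (rule not_good_pigeonhole[rotated])
    fix u v assume uv: "u \<in> S" "v \<in> S" "u \<noteq> v" "E u x = E v x"
    then have in_K: "u \<in> K" "v \<in> K" using S K False by auto
    then have "E u v" using uv K unfolding is_clique_def by auto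
    moreover have "E u w = E v w" if "w \<in> V - {u, v}" for w
    proof (cases "w = x")
      case False then have "w \<in> K" using that K by auto
      then show ?thesis using in_K that K unfolding is_clique_def by auto
    qed (use uv in simp)
    ultimately show "E u v \<and> (\<forall>w\<in>V - S. d u w = d v w)" using twins_same_dist[of u v] uv by blast
  qed auto
qed

lemma clique_dist: "is_clique E K \<Longrightarrow> K \<subseteq> V \<Longrightarrow> u \<in> K \<Longrightarrow> w \<in> K \<Longrightarrow> u \<noteq> w \<Longrightarrow> d u w = 1"
  using d_1 unfolding is_clique_def by blast

text \<open>If \<open>y\<close> is in \<open>S\<close> too, all outside vertices are at distance 1
  from the remaining members. Otherwise only \<open>y\<close> can separate the three clique vertices
  of \<open>S\<close>, and being pairwise adjacent they have at most two distinct distances to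
  \<open>y\<close>.\<close>

lemma not_good4_split:
  assumes K: "K \<subseteq> V" "is_clique E K" "V \<subseteq> insert x (insert y K)"
    and S: "S \<subseteq> V" "card S = 4" "x \<in> S" "y \<in> V"
  shows "\<not> good S"
proof (cases "y \<in> S")
  case True
  have "card {x, y} \<le> 2" by (simp add: card_insert_if)
  then have "2 \<le> card (S - {x, y})" using diff_card_le_card_Diff[of "{x, y}" S] S(2) by simp
  moreover have "card ((\<lambda>_. ()) ` (S - {x, y})) \<le> card (UNIV :: unit set)" by (intro card_mono) auto
  ultimately have "card ((\<lambda>_. ()) ` (S - {x, y})) < card (S - {x, y})" by simp
  then show ?thesis
  proof (rule not_good_pigeonhole[rotated])
    fix u v assume uv: "u \<in> S - {x, y}" "v \<in> S - {x, y}" "u \<noteq> v"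
    then have in_K: "u \<in> K" "v \<in> K" using S K by auto
    have "d u w = d v w" if "w \<in> V - S" for w
    proof -
      have "w \<in> V" "w \<noteq> x" "w \<noteq> y" and ne: "u \<noteq> w" "v \<noteq> w" using that S(3) True uv by blast+
      then have "w \<in> K" using K(3) by blast
      then show ?thesis
        using clique_dist[OF K(2,1) in_K(1), of w] clique_dist[OF K(2,1) in_K(2), of w] ne by simp
    qed
    then show "E u v \<and> (\<forall>w\<in>V - S. d u w = d v w)" using in_K uv K unfolding is_clique_def by auto
  qed auto
next
  case False
  let ?T = "S - {x}"
  have T: "card ?T = 3" "?T \<subseteq> K" using S K False by auto
  define m where "m = Min ((\<lambda>u. d u y) ` ?T)"
  have "finite ?T" using S(1) fin finite_subset by blast
  moreover have "?T \<noteq> {}" using T(1) by (metis card.empty zero_neq_numeral)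
  ultimately have finT: "finite ?T" "?T \<noteq> {}" .
  have "m \<in> (\<lambda>u. d u y) ` ?T" unfolding m_def using finT by (intro Min_in) auto
  then obtain u0 where u0: "u0 \<in> ?T" "d u0 y = m" by blast
  have "d u y \<in> {m, Suc m}" if "u \<in> ?T" for u
  proof -
    have "m \<le> d u y" unfolding m_def using finT that by (intro Min_le) auto
    moreover have "d u y \<le> Suc m"
    proof (cases "u = u0")
      case False
      then have "E u u0" using u0 that T K unfolding is_clique_def by blast
      then show ?thesis using d_step[of u u0 y] u0 S by simp
    qed (use u0 in simp)
    ultimately show ?thesis by auto
  qed
  then have "(\<lambda>u. d u y) ` ?T \<subseteq> {m, Suc m}" by blast
  then have "card ((\<lambda>u. d u y) ` ?T) \<le> card {m, Suc m}" by (intro card_mono) auto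
  then have "card ((\<lambda>u. d u y) ` ?T) < card ?T" using T by simp
  then show ?thesis
  proof (rule not_good_pigeonhole[rotated])
    fix u v assume uv: "u \<in> ?T" "v \<in> ?T" "u \<noteq> v" "d u y = d v y"
    then have in_K: "u \<in> K" "v \<in> K" using T by auto
    have "d u w = d v w" if "w \<in> V - S" for w
    proof (cases "w = y")
      case False
      then have "w \<in> K" "u \<noteq> w" "v \<noteq> w" using that K S uv by auto
      then show ?thesis using in_K clique_dist[OF K(2,1)] by simp
    qed (use uv in simp)
    then show "E u v \<and> (\<forall>w\<in>V - S. d u w = d v w)" using in_K uv K unfolding is_clique_def by auto
  qed auto
qed

text \<open>Four adjacency patterns to \<open>x\<close>, \<open>y\<close> inside \<open>K\<close>
  would form a \<open>gamma\<close>, so \<open>K\<close> has at most three twin classes.\<close>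

lemma not_good4_of_clique:
  assumes K: "K \<subseteq> V" "is_clique E K" "V = insert x (insert y K)" "x \<notin> K" "y \<notin> K" "x \<noteq> y"
    and no_gamma: "\<And>a b c e. \<not> gamma a b c e x y"
    and S: "S \<subseteq> V" "card S = 4"
  shows "\<not> good S"
proof (cases "x \<in> S \<or> y \<in> S")
  case True
  have "V \<subseteq> insert x (insert y K)" "V \<subseteq> insert y (insert x K)" "x \<in> V" "y \<in> V" using K(3) by auto
  then show ?thesis
    using True not_good4_split[OF K(1,2) _ S, of x y] not_good4_split[OF K(1,2) _ S, of y x] by blast
next
  case False
  then have SK: "S \<subseteq> K" using S K by auto
  let ?f = "\<lambda>u. (E u x, E u y)"
  have "?f ` K \<noteq> UNIV"
  proof
    assume U: "?f ` K = UNIV"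
    have ex: "\<exists>u\<in>K. E u x = p \<and> E u y = q" for p q
    proof -
      have "(p, q) \<in> ?f ` K" unfolding U by simp
      then show ?thesis by auto
    qed
    obtain a where a: "a \<in> K" "E a x" "E a y" using ex[of True True] by auto
    obtain b where b: "b \<in> K" "E b x" "\<not> E b y" using ex[of True False] by auto
    obtain c where c: "c \<in> K" "\<not> E c x" "E c y" using ex[of False True] by auto
    obtain e where e: "e \<in> K" "\<not> E e x" "\<not> E e y" using ex[of False False] by auto
    note v = a(1) b(1) c(1) e(1) and f = a(2,3) b(2,3) c(2,3) e(2,3)
    have dist: "distinct [a, b, c, e]" using f by auto
    then have "E a b" "E a c" "E a e" "E b c" "E b e" "E c e"
      using K(2) v unfolding is_clique_def by auto
    moreover have "x \<notin> {a, b, c, e}" "y \<notin> {a, b, c, e}" using v K(4,5) by auto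
    moreover have "{a, b, c, e, x, y} \<subseteq> V" using v K(3) by auto
    ultimately have "gamma a b c e x y" unfolding gamma_def using dist f K(6) by auto
    then show False using no_gamma by blast
  qed
  then have "?f ` S \<subset> UNIV" using SK by blast
  then have "card (?f ` S) < card (UNIV :: (bool \<times> bool) set)" by (intro psubset_card_mono) auto
  moreover have "card (UNIV :: (bool \<times> bool) set) = 4"
    unfolding UNIV_Times_UNIV[symmetric] card_cartesian_product by (simp add: UNIV_bool)
  ultimately have "card (?f ` S) < card S" using S by simp
  then show ?thesis
  proof (rule not_good_pigeonhole[rotated])
    fix u v assume uv: "u \<in> S" "v \<in> S" "u \<noteq> v" "?f u = ?f v"
    then have in_K: "u \<in> K" "v \<in> K" using SK by auto
    then have "E u v" using uv K unfolding is_clique_def by auto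
    moreover have "E u w = E v w" if w: "w \<in> V - {u, v}" for w
    proof (cases "w \<in> K")
      case True
      then show ?thesis using in_K w K unfolding is_clique_def by auto
    next
      case False
      then have "w = x \<or> w = y" using w K(3) by blast
      then show ?thesis using uv(4) by auto
    qed
    ultimately show "E u v \<and> (\<forall>w\<in>V - S. d u w = d v w)" using twins_same_dist[of u v] uv by blast
  qed auto
qed

lemma clique_adj: "is_clique E K \<Longrightarrow> u \<in> K \<Longrightarrow> v \<in> K \<Longrightarrow> u \<noteq> v \<Longrightarrow> E u v"
  unfolding is_clique_def by blast

section \<open>Good triples beside a maximum clique missing two vertices\<close>

lemma has_nbr: assumes "u \<in> V" "v \<in> V" "u \<noteq> v" shows "\<exists>w. E u w"
proof -
  obtain k where "d u v = Suc k" using d_0[OF assms(1,2)] assms(3) by (cases "d u v") auto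
  then show ?thesis using d_pred[OF assms(1,2)] by metis
qed

text \<open>Since \<open>y\<close> hangs at \<open>x\<close>, the witness \<open>y\<close> has
  distance 1 to \<open>x\<close>, distance 2 to a neighbour of \<open>x\<close> in \<open>K\<close>,
  and a larger distance to the non-neighbour \<open>b\<close>.\<close>

lemma good3_pendant:
  assumes K: "K \<subseteq> V" "is_clique E K" "V = insert x (insert y K)" "x \<notin> K" "y \<notin> K" "x \<noteq> y"
    and x: "b \<in> K" "\<not> E x b" and y: "\<And>k. k \<in> K \<Longrightarrow> \<not> E y k"
  shows "\<exists>S\<subseteq>V. card S = 3 \<and> good S"
proof -
  have V: "x \<in> V" "y \<in> V" "b \<in> V" using K x by auto
  have yx: "z = x" if "E y z" for z using EV(2)[OF that] y that K(3) E_irr by blast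
  then have Eyx: "E y x" using has_nbr[OF V(2,1)] K(6) by metis
  \<comment> \<open>Otherwise \<open>x\<close> and \<open>y\<close> have only each other as
    neighbours, and each of their distances to \<open>b\<close> would exceed the other by
    one.\<close>
  have "\<exists>a\<in>K. E x a"
  proof (rule ccontr)
    assume n: "\<not> (\<exists>a\<in>K. E x a)"
    have xy: "z = y" if "E x z" for z using EV(2)[OF that] n that K(3) E_irr by blast
    have "d x b \<noteq> 0" "d y b \<noteq> 0" using d_0 V K x by metis+
    then obtain k l where kl: "d x b = Suc k" "d y b = Suc l" by (metis not0_implies_Suc)
    then have "d y b = k" "d x b = l" using d_pred[OF V(1,3)] d_pred[OF V(2,3)] xy yx by metis+
    then show False using kl by simp
  qed
  then obtain a where a: "a \<in> K" "E x a" by blast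
  have aV: "a \<in> V" using a K by auto
  have "a \<noteq> b" using a x by auto
  then have ab: "E a b" "a \<noteq> b" using clique_adj[OF K(2) a(1) x(1)] by simp_all
  have "E x y" using Eyx E_sym by blast
  moreover have nay: "\<not> E a y" "\<not> E b y" using y a x E_sym by blast+
  ultimately have xa: "d x y \<noteq> d a y" using adj_dist V aV by blast
  have "d a y = 2" using d_2[OF aV V(2)] nay a K(5) \<open>E x y\<close> E_sym by blast
  moreover have "d b y \<noteq> 2" using d_2[OF V(3,2)] yx x(2) E_sym by blast
  ultimately have "d a y \<noteq> d b y" by simp
  moreover have "y \<in> V - {x, a, b}" using V K a x by auto
  ultimately have "good {x, a, b}" using xa x(2) by (intro goodI3) blast+
  moreover have "x \<noteq> a" "x \<noteq> b" using K(4) a(1) x(1) by auto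
  ultimately show ?thesis using V aV ab(2) by (intro exI[of _ "{x, a, b}"]) simp
qed

lemma good3_of_clique:
  assumes K: "K \<subseteq> V" "is_clique E K" "V = insert x (insert y K)" "x \<notin> K" "y \<notin> K" "x \<noteq> y"
    and max: "\<And>C. C \<subseteq> V \<Longrightarrow> is_clique E C \<Longrightarrow> card C \<le> card K"
  shows "\<exists>S\<subseteq>V. card S = 3 \<and> good S"
proof -
  have V: "x \<in> V" "y \<in> V" and finK: "finite K" using K fin finite_subset by auto
  have non: "\<exists>b\<in>K. \<not> E v b" if "v \<in> V - K" for v
  proof (rule ccontr)
    assume "\<not> ?thesis"
    then have "is_clique E (insert v K)" using K(2) E_sym unfolding is_clique_def by blast
    moreover have "insert v K \<subseteq> V" using that K(1) by blast
    ultimately show False using max[of "insert v K"] that finK by simp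
  qed
  obtain bx b2 where b: "bx \<in> K" "\<not> E x bx" "b2 \<in> K" "\<not> E y b2"
    using non[of x] non[of y] V K(4,5) by blast
  have K': "V = insert y (insert x K)" using K(3) by auto
  consider "\<forall>k\<in>K. \<not> E y k" | "\<forall>k\<in>K. \<not> E x k" | a a' where "a \<in> K" "E x a" "a' \<in> K" "E y a'" by blast
  then show ?thesis
  proof cases
    case 1 then show ?thesis using good3_pendant[OF K b(1,2)] by blast
  next
    case 2 then show ?thesis using good3_pendant[OF K(1,2) K' K(5,4) K(6)[symmetric] b(3,4)] by blast
  next
    case (3 a a')
    show ?thesis
    \<comment> \<open>If \<open>x\<close> separates \<open>p\<close> and \<open>q\<close> but
      \<open>y\<close> does not, a vertex \<open>r\<close> of \<open>K\<close> differing from both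
      at \<open>y\<close> completes a good triple. Otherwise \<open>x\<close> and \<open>y\<close>
      have equal or complementary neighbourhoods in \<open>K\<close>, and \<open>{x, a, bx}\<close>
      is good.\<close>
    proof (cases "\<exists>p\<in>K. \<exists>q\<in>K. E x p \<and> \<not> E x q \<and> E y p = E y q")
      case True
      then obtain p q where pq: "p \<in> K" "q \<in> K" "E x p" "\<not> E x q" "E y p = E y q" by blast
      obtain r where r: "r \<in> K" "E y r \<noteq> E y p" using 3 b by blast
      have rV: "p \<in> V" "q \<in> V" "r \<in> V" using pq r K by auto
      have "E p x \<noteq> E q x" "E p y \<noteq> E r y" "E q y \<noteq> E r y" using pq r E_sym by blast+
      then have "d p x \<noteq> d q x" "d p y \<noteq> d r y" "d q y \<noteq> d r y" using adj_dist rV V by blast+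
      moreover have "x \<in> V - {p, q, r}" "y \<in> V - {p, q, r}" using V pq r K by auto
      ultimately have "good {p, q, r}" by (intro goodI3) blast+
      moreover have "p \<noteq> q" "p \<noteq> r" "q \<noteq> r" using pq r by auto
      ultimately show ?thesis using rV by (intro exI[of _ "{p, q, r}"]) simp
    next
      case False
      then have opp: "E y p \<noteq> E y q" if "p \<in> K" "q \<in> K" "E x p" "\<not> E x q" for p q using that by blast
      have aV: "a \<in> V" "bx \<in> V" using 3 b K by auto
      have "a \<noteq> bx" using 3 b by auto
      then have ab: "E a bx" "a \<noteq> bx" using clique_adj[OF K(2) 3(1) b(1)] by simp_all
      have "E a y \<noteq> E bx y" using opp 3 b E_sym by blast
      then have day: "d a y \<noteq> d bx y" using adj_dist aV V by blast
      have out: "y \<in> V - {x, a, bx}" using V K 3 b by auto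
      have "\<exists>w\<in>V - {x, a, bx}. d x w \<noteq> d a w"
      proof (cases "E x y = E a y")
        case False
        then have "d x y \<noteq> d a y" using adj_dist aV V by blast
        then show ?thesis using out by blast
      next
        case same: True
        show ?thesis
        proof (cases "E a y")
          case True
          show ?thesis
          proof (cases "\<exists>b'\<in>K. b' \<noteq> bx \<and> \<not> E x b'")
            case True
            then obtain b' where b': "b' \<in> K" "b' \<noteq> bx" "\<not> E x b'" by blast
            then have "a \<noteq> b'" using 3 by auto
            then have "b' \<in> V - {x, a, bx}" "E a b'"
              using clique_adj[OF K(2) 3(1) b'(1)] b' K(1,4) by auto
            moreover from this have "d x b' \<noteq> d a b'" using b' adj_dist aV V by blast
            ultimately show ?thesis by blast
          next
            case False
            \<comment> \<open>Here \<open>bx\<close> is the only vertex of \<open>K\<close> missed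
              by \<open>x\<close> and by \<open>y\<close>; exchanging it for both would enlarge the
              maximum clique.\<close>
            let ?C = "insert x (insert y (K - {bx}))"
            have "E y k" if "k \<in> K - {bx}" for k
              using opp[of k bx] opp[of a bx] that False 3 b \<open>E a y\<close> E_sym by blast
            moreover have "E x k" if "k \<in> K - {bx}" for k using that False by blast
            moreover have "E x y" using same True by simp
            ultimately have "is_clique E ?C" using K(2) E_sym unfolding is_clique_def by blast
            moreover have "?C \<subseteq> V" using K by blast
            moreover have "card ?C = Suc (card K)"
              using K finK b by (simp add: card_Suc_Diff1 del: card_Diff_insert)
            ultimately show ?thesis using max[of ?C] by simp
          qed
        next
          case False
          then have n: "\<not> E x y" "\<not> E a y" "E bx y" using same \<open>E a y \<noteq> E bx y\<close> by auto
          \<comment> \<open>The neighbourhoods in \<open>K\<close> are complementary: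
            \<open>a\<close> reaches \<open>y\<close> through \<open>bx\<close>, while
            \<open>x\<close> and \<open>y\<close> have no common neighbour.\<close>
          have "d a y = 2" using d_2[OF aV(1) V(2)] n ab 3 K(5) by blast
          moreover have "d x y \<noteq> 2"
          proof
            assume "d x y = 2"
            then obtain z where z: "E x z" "E z y" using d_2[OF V] by blast
            then have "z \<in> K" using EV(2) K(3) E_irr n by blast
            then show False using opp[of z bx] z b n E_sym by blast
          qed
          ultimately have "d x y \<noteq> d a y" by simp
          then show ?thesis using out by blast
        qed
      qed
      then have "good {x, a, bx}" using day out b(2) by (intro goodI3) blast+
      moreover have "x \<noteq> a" "x \<noteq> bx" using K(4) 3(1) b(1) by auto
      ultimately show ?thesis using V aV ab(2) by (intro exI[of _ "{x, a, bx}"]) simp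
    qed
  qed
qed

end

lemma (in no_good4) structure_dichotomy:
  "graph_iso V E {0..<5} C5_E \<or>
    (\<exists>lam mu :: nat. lam \<ge> mu \<and> mu \<ge> 2 \<and> lam + mu < card V
      \<and> graph_iso V E {0..<card V} (Kminus_E (card V) lam mu))"
proof -
  have Eh: "E u v \<longleftrightarrow> u \<noteq> v \<and> \<not> coadj u v" if "u \<in> V" "v \<in> V" for u v
    using that E_irr unfolding coadj_def by blast
  show ?thesis
  proof (cases "\<forall>p q r s. coadj p q \<longrightarrow> coadj q r \<longrightarrow> coadj r s \<longrightarrow> p \<noteq> s \<longrightarrow> coadj p s")
    case False
    then obtain p q r s where P: "coadj p q" "coadj q r" "coadj r s" "\<not> coadj p s" "p \<noteq> s" by blast
    obtain z where z: "V = {p, q, r, s, z}" "distinct [p, q, r, s, z]" "coadj s z" "coadj z p"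
      using P4_in_C5[OF P] .
    have V: "p \<in> V" "q \<in> V" "r \<in> V" "s \<in> V" "z \<in> V" using z(1) by simp_all
    have "\<not> coadj p r" "\<not> coadj q s" "\<not> coadj r z" "\<not> coadj s p" "\<not> coadj z q"
      using P z coadj_tri coadj_comm by blast+
    then have "E p r" "E r z" "E z q" "E q s" "E s p"
      using Eh V z(2) coadj_comm[of z q] by auto
    moreover have "\<not> E p z" "\<not> E r q" "\<not> E z s" "\<not> E q p" "\<not> E s r"
      using P z(3,4) E_sym unfolding coadj_def by blast+
    \<comment> \<open>The diagonals of a five-cycle form a five-cycle; taking every second vertex
      gives the order \<open>p r z q s\<close>.\<close>
    moreover have "distinct [p, r, z, q, s]" "V = {p, r, z, q, s}" using z(1,2) by auto
    ultimately have "graph_iso V E {0..<5} C5_E" unfolding C5_iso_iff by blast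
    then show ?thesis by blast
  next
    case True
    obtain X Y where XY: "X \<subseteq> V" "Y \<subseteq> V" "X \<inter> Y = {}" "X \<union> Y \<noteq> V" "2 \<le> card X" "2 \<le> card Y"
      "\<And>u v. coadj u v \<longleftrightarrow> u \<in> X \<and> v \<in> Y \<or> u \<in> Y \<and> v \<in> X"
      by (rule complete_bipartite_complement[OF True]) (rule that)
    have fin': "finite X" "finite Y" using XY fin finite_subset by auto
    have "X \<union> Y \<subset> V" using XY(1,2,4) by blast
    then have "card (X \<union> Y) < card V" using fin by (rule psubset_card_mono[rotated])
    then have lt: "card X + card Y < card V" using card_Un_disjoint[OF fin' XY(3)] by simp
    have iso: "graph_iso V E {0..<card V} (Kminus_E (card V) (card A) (card B))"
      if "A = X \<and> B = Y \<or> A = Y \<and> B = X" for A B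
    proof -
      have le: "card A + card B \<le> card V" using that lt by auto
      have "\<forall>u\<in>V. \<forall>v\<in>V. E u v \<longleftrightarrow> u \<noteq> v \<and> \<not> (u \<in> A \<and> v \<in> B) \<and> \<not> (u \<in> B \<and> v \<in> A)"
        using that Eh XY(7) by blast
      moreover have "A \<subseteq> V" "B \<subseteq> V" "A \<inter> B = {}" using that XY(1-3) by blast+
      ultimately show ?thesis unfolding Kminus_iso_iff[OF fin le] by blast
    qed
    show ?thesis
    proof (cases "card Y \<le> card X")
      case True
      then show ?thesis using iso[of X Y] lt XY(6) by blast
    next
      case False
      then have "card X \<le> card Y" "card Y + card X < card V" using lt by simp_all
      then show ?thesis using iso[of Y X] XY(5) by blast
    qed
  qed
qed

theorem theorem2p4:
  fixes V :: "'a set" and E :: "'a \<Rightarrow> 'a \<Rightarrow> bool"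
  assumes "sgraph V E" and "connected_graph V E" and "card V \<ge> 5"
  shows "local_metric_dim V E = card V - 3 \<longleftrightarrow>
     ((clique_number V E = card V - 2 \<and> \<not> has_induced V E {1..6} Gamma1_E
                                      \<and> \<not> has_induced V E {1..6} Gamma2_E)
      \<or> graph_iso V E {0..<5} C5_E
      \<or> (\<exists>lam mu :: nat. lam \<ge> mu \<and> mu \<ge> 2 \<and> lam + mu < card V
            \<and> graph_iso V E {0..<card V} (Kminus_E (card V) lam mu)))"
    (is "?L \<longleftrightarrow> ?clique \<or> ?C5 \<or> ?Kminus")
proof -
  interpret conn_graph V E using assms by unfold_locales
  let ?G3 = "\<exists>S\<subseteq>V. card S = 3 \<and> good S" and ?G4 = "\<exists>S\<subseteq>V. card S = 4 \<and> good S"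
  have dim: "?L \<longleftrightarrow> ?G3 \<and> \<not> ?G4" using dim_eq_iff[OF assms(3)] .
  have no_gamma: "\<not> gamma a b c e x y" if "\<not> ?G4" for a b c e x y
  proof
    assume g: "gamma a b c e x y"
    then have "{a, b, c, e} \<subseteq> V" "card {a, b, c, e} = 4" unfolding gamma_def by auto
    then show False using gamma_good[OF g] that by blast
  qed
  show ?thesis
  proof
    assume ?L
    then have G: ?G3 "\<not> ?G4" using dim by simp_all
    have "\<not> card V - 1 \<le> clique_number V E"
    proof
      assume "card V - 1 \<le> clique_number V E"
      then obtain K where K: "K \<subseteq> V" "is_clique E K" "card K = card V - 1" using clique_of_card by blast
      then have "card (V - K) = 1" using assms(3) fin by (simp add: card_Diff_subset finite_subset)
      then obtain x where "V - K = {x}" using card_1_singletonE by blast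
      then have "V \<subseteq> insert x K" by blast
      then show False using not_good3_of_big_clique[OF K(1,2)] G(1) by blast
    qed
    then consider "clique_number V E = card V - 2" | "clique_number V E < card V - 2" by linarith
    then show "?clique \<or> ?C5 \<or> ?Kminus"
    proof cases
      case 1
      have "\<not> (has_induced V E {1..6} Gamma1_E \<or> has_induced V E {1..6} Gamma2_E)"
        using gamma_of_induced no_gamma[OF G(2)] by metis
      then show ?thesis using 1 by simp
    next
      case 2
      \<comment> \<open>Without such a pair, \<open>V - {p, q}\<close> would be a clique of at least
        n - 2 vertices; the case \<open>p = q\<close> is included.\<close>
      have tau: "\<exists>u v. u \<in> V - {p, q} \<and> v \<in> V - {p, q} \<and> u \<noteq> v \<and> \<not> E u v" for p q
      proof (rule ccontr)
        assume "\<not> ?thesis"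
        then have "is_clique E (V - {p, q})" unfolding is_clique_def by blast
        then have "card (V - {p, q}) \<le> clique_number V E" by (intro clique_number_ge) auto
        moreover have "card {p, q} \<le> 2" by (simp add: card_insert_if)
        ultimately show False using 2 diff_card_le_card_Diff[of "{p, q}" V] by simp
      qed
      interpret no_good4 V E using G(2) tau by unfold_locales blast+
      show ?thesis using structure_dichotomy by blast
    qed
  next
    assume "?clique \<or> ?C5 \<or> ?Kminus"
    then consider ?clique | ?C5 | ?Kminus by blast
    then have "?G3 \<and> \<not> ?G4"
    proof cases
      case 1
      then obtain K where K: "K \<subseteq> V" "is_clique E K" "card K = card V - 2"
        using clique_of_card[of "card V - 2"] by auto
      then have "card (V - K) = 2" using assms(3) fin by (simp add: card_Diff_subset finite_subset)
      then obtain x y where xy: "V - K = {x, y}" "x \<noteq> y" by (meson card_2_iff)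
      then have Vxy: "V = insert x (insert y K)" "x \<notin> K" "y \<notin> K" using K(1) by blast+
      have "card C \<le> card K" if "C \<subseteq> V" "is_clique E C" for C
        using clique_number_ge[OF that] 1 K(3) by simp
      then have ?G3 using good3_of_clique[OF K(1,2) Vxy xy(2)] by blast
      moreover have "\<not> gamma a b c e x y" for a b c e using induced_of_gamma 1 by blast
      then have "\<not> ?G4" using not_good4_of_clique[OF K(1,2) Vxy xy(2)] by blast
      ultimately show ?thesis by blast
    next
      case 2
      then obtain a b c e f where *: "distinct [a, b, c, e, f]" "V = {a, b, c, e, f}"
        "E a b" "E b c" "E c e" "E e f" "E f a" "\<not> E a c" "\<not> E b e" "\<not> E c f" "\<not> E e a" "\<not> E f b"
        unfolding C5_iso_iff by blast
      show ?thesis using C5_dim[OF *] by blast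
    next
      case 3
      then obtain lam mu where lm: "lam \<ge> mu" "mu \<ge> 2" "lam + mu < card V"
        "graph_iso V E {0..<card V} (Kminus_E (card V) lam mu)" by blast
      then obtain A B where AB: "A \<subseteq> V" "B \<subseteq> V" "A \<inter> B = {}" "card A = lam" "card B = mu"
        "\<forall>u\<in>V. \<forall>v\<in>V. E u v \<longleftrightarrow> u \<noteq> v \<and> \<not> (u \<in> A \<and> v \<in> B) \<and> \<not> (u \<in> B \<and> v \<in> A)"
        using Kminus_iso_iff[OF fin, of lam mu] by auto
      have "A \<union> B \<noteq> V" using card_Un_le[of A B] AB(4,5) lm(3) by auto
      then show ?thesis using Kminus_dim[OF AB(1-3) _ _ _ AB(6)] AB(4,5) lm by auto
    qed
    then show ?L using dim by blast
  qed
qed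

end
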